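(* Let $\mathbf k$ be a field of characteristic $0$, $\mathcal L$ a complete filtered Lie algebra over $\mathbf k$, $X_0\in\mathcal L$, and $B\in\mathcal L_{\ge1}$. Suppose that $B=\sum_{n\in\mathcal N}B_n$ is a formally convergent series, indexed by a nonempty set $\mathcal N$, with $B_n\in\mathcal L_{\ge1}$ and $[X_0,B_n]=\varphi(n)B_n$ for each $n\in\mathcal N$, for some function $\varphi:\mathcal N\to\mathbf k$. For words put $\varphi(n_1\cdots n_r)=\varphi(n_1)+\cdots+\varphi(n_r)$, and let $$T^{n_1\cdots n_r}(\varepsilon)=\frac1{(\varphi(n_1)+\varepsilon)(\varphi(n_1n_2)+2\varepsilon)\cdots(\varphi(n_1\cdots n_r)+r\varepsilon)}\in\mathbf k((\varepsilon)).$$ Define $U_-^\varnothing=U_+^\varnothing=1$ and, by induction on the length of the nonempty word $\underline n$, $$U_-^{\underline n}=-\pi_-(D^{\underline n}),\qquad U_+^{\underline n}=\pi_+(D^{\underline n}),\qquad D^{\underline n}=\sum_{\underline n=\underline a\,\underline b,\ \underline b\ne\varnothing}U_-^{\underline a}\,T^{\underline b},$$ and then $$R^{\underline n}=-r(\underline n)\,\big(\text{residue of }U_-^{\underline n}(\varepsilon)\big)\in\mathbf k,\qquad S^{\underline n}=\text{constant term of }U_+^{\underline n}(\varepsilon)\in\mathbf k .$$ Then $$N=\sum_{r\ge1}\ \sum_{n_1,\dots,n_r\in\mathcal N}\tfrac1r R^{n_1\cdots n_r}[B_{n_1},[\ldots[B_{n_{r-1}},B_{n_r}]\ldots]],\qquad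 \Psi=\sum_{r\ge0}\ \sum_{n_1,\dots,n_r\in\mathcal N}S^{n_1\cdots n_r}\,\mathrm{ad}_{B_{n_1}}\cdots\mathrm{ad}_{B_{n_r}}$$ provide a solution of the normalization problem: $\Psi$ is a Lie algebra automorphism of $\mathcal L$, $\Psi(X_0+B)=X_0+N$ and $[X_0,N]=0$.
   Context: A complete filtered Lie algebra is a Lie algebra $\mathcal L$ with a decreasing filtration by subspaces $\mathcal L=\mathcal L_{\ge0}\supset\mathcal L_{\ge1}\supset\mathcal L_{\ge2}\supset\cdots$ such that $[\mathcal L_{\ge m},\mathcal L_{\ge n}]\subset\mathcal L_{\ge m+n}$ for all $m,n\in\mathbb N$, $\bigcap_m\mathcal L_{\ge m}=\{0\}$, and $\mathcal L$ is complete for the distance $d(X,Y)=2^{-\mathrm{ord}(Y-X)}$, where $\mathrm{ord}(X)\ge m\iff X\in\mathcal L_{\ge m}$. A series $\sum_n B_n$ is formally convergent if, for each $m$, all but finitely many $B_n$ lie in $\mathcal L_{\ge m}$; the series defining $N$ and $\Psi$ (the latter applied to any element of $\mathcal L$) are understood as convergent in this sense. $\mathrm{ad}_Y$ is the map $X\mapsto[Y,X]$. Words are finite sequences of elements of $\mathcal N$, $\varnothing$ is the empty word, $r(\underline n)$ is the length of $\underline n$, and $\underline a\,\underline b$ is concatenation. For $r=1$ the nested bracket is $B_{n_1}$; the $r=0$ term of $\Psi$ is $S^\varnothing\,\mathrm{Id}=\mathrm{Id}$. $\pi_\pm:\mathbf k((\varepsilon))\to\mathbf K_\pm$ are the projectors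 associated with the decomposition $\mathbf k((\varepsilon))=\mathbf K_+\oplus\mathbf K_-$, $\mathbf K_+=\mathbf k[[\varepsilon]]$, $\mathbf K_-=\varepsilon^{-1}\mathbf k[\varepsilon^{-1}]$. The constant term and residue of $\sum_n c_n\varepsilon^n$ are $c_0$ and $c_{-1}$. *)

theory Defs
  imports "HOL-Analysis.Analysis" "HOL-Computational_Algebra.Formal_Laurent_Series"
begin

subsection \<open>Complete filtered Lie algebras\<close>

locale lie_algebra = vector_space smul
  for smul :: "'k::field \<Rightarrow> 'a::ab_group_add \<Rightarrow> 'a" +
  fixes bracket :: "'a \<Rightarrow> 'a \<Rightarrow> 'a"
  assumes bracket_add_left: "bracket (x + y) z = bracket x z + bracket y z"
    and bracket_add_right: "bracket x (y + z) = bracket x y + bracket x z"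
    and bracket_scale_left: "bracket (smul c x) y = smul c (bracket x y)"
    and bracket_scale_right: "bracket x (smul c y) = smul c (bracket x y)"
    and bracket_self: "bracket x x = 0"
    and jacobi: "bracket x (bracket y z) + bracket y (bracket z x) + bracket z (bracket x y) = 0"

definition lie_automorphism ::
  "('k::field \<Rightarrow> 'a::ab_group_add \<Rightarrow> 'a) \<Rightarrow> ('a \<Rightarrow> 'a \<Rightarrow> 'a) \<Rightarrow> ('a \<Rightarrow> 'a) \<Rightarrow> bool" where
  "lie_automorphism smul bracket f \<longleftrightarrow>
     Vector_Spaces.linear smul smul f \<and> bij f \<and>
     (\<forall>x y. f (bracket x y) = bracket (f x) (f y))"

definition filt_ord :: "(nat \<Rightarrow> 'a::ab_group_add set) \<Rightarrow> 'a \<Rightarrow> enat" where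
  "filt_ord L x = (SUP m\<in>{m. x \<in> L m}. enat m)"

text \<open>\<open>2^{-ord (y - x)}\<close>, with the convention \<open>2^{-\<infinity>} = 0\<close>.\<close>

definition filt_dist :: "(nat \<Rightarrow> 'a::ab_group_add set) \<Rightarrow> 'a \<Rightarrow> 'a \<Rightarrow> real" where
  "filt_dist L x y = (case filt_ord L (y - x) of enat m \<Rightarrow> (1/2) ^ m | \<infinity> \<Rightarrow> 0)"

locale filtered_lie_algebra = lie_algebra smul bracket
  for smul :: "'k::field \<Rightarrow> 'a::ab_group_add \<Rightarrow> 'a" and bracket :: "'a \<Rightarrow> 'a \<Rightarrow> 'a" +
  fixes L :: "nat \<Rightarrow> 'a set"
  assumes filt_0: "L 0 = UNIV"
    and filt_subspace: "subspace (L m)"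
    and filt_decreasing: "L (Suc m) \<subseteq> L m"
    and filt_bracket: "x \<in> L m \<Longrightarrow> y \<in> L n \<Longrightarrow> bracket x y \<in> L (m + n)"
    and filt_separated: "(\<Inter>m. L m) = {0}"
begin

lemma filt_antimono: "m \<le> n \<Longrightarrow> L n \<subseteq> L m"
  using filt_decreasing by (rule lift_Suc_antimono_le)

lemma filt_ord_ge_iff: "enat m \<le> filt_ord L x \<longleftrightarrow> x \<in> L m"
proof
  assume "x \<in> L m"
  then show "enat m \<le> filt_ord L x"
    unfolding filt_ord_def by (intro SUP_upper) simp
next
  assume le: "enat m \<le> filt_ord L x"
  show "x \<in> L m"
  proof (rule ccontr)
    assume x: "x \<notin> L m"
    have "k < m" if "x \<in> L k" for k
      using that x filt_antimono[of m k] by (meson in_mono not_le)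
    then have "filt_ord L x \<le> enat (m - 1)"
      unfolding filt_ord_def by (intro SUP_least) force
    moreover have "m \<noteq> 0"
      using x filt_0 by (cases m) auto
    ultimately show False
      using le by (auto dest: order_trans)
  qed
qed

lemma filt_dist_le_iff: "filt_dist L x y \<le> (1/2) ^ m \<longleftrightarrow> y - x \<in> L m"
  unfolding filt_ord_ge_iff[symmetric] filt_dist_def
  by (auto split: enat.split simp: power_decreasing_iff)

lemma filt_dist_eq_0_iff: "filt_dist L x y = 0 \<longleftrightarrow> x = y"
proof
  assume "filt_dist L x y = 0"
  then have "y - x \<in> L m" for m
    unfolding filt_dist_le_iff[symmetric] by simp
  then have "y - x \<in> (\<Inter>m. L m)" by blast
  then show "x = y" using filt_separated by simp
next
  assume "x = y"
  then have "enat m \<le> filt_ord L (y - x)" for m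
    unfolding filt_ord_ge_iff using filt_subspace subspace_0 by simp
  then have "filt_ord L (y - x) = \<infinity>"
    by (metis enat_ile enat_ord_simps(1) Suc_n_not_le_n not_infinity_eq)
  then show "filt_dist L x y = 0" unfolding filt_dist_def by simp
qed

lemma filt_dist_nonneg: "0 \<le> filt_dist L x y"
  unfolding filt_dist_def by (auto split: enat.split)

lemma filt_dist_cases: "filt_dist L x y = 0 \<or> (\<exists>m. filt_dist L x y = (1/2) ^ m)"
  unfolding filt_dist_def by (auto split: enat.split)

lemma filt_dist_commute: "filt_dist L x y = filt_dist L y x"
proof -
  have "y - x \<in> L m \<longleftrightarrow> x - y \<in> L m" for m
    using subspace_neg[OF filt_subspace] by (metis minus_diff_eq)
  then show ?thesis
    unfolding filt_dist_def filt_ord_def by simp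
qed

lemma filt_dist_ultrametric: "filt_dist L x z \<le> max (filt_dist L x y) (filt_dist L y z)"
proof (cases "x = y \<or> y = z")
  case True
  then show ?thesis by (auto simp: max_def)
next
  case False
  then obtain a b where ab: "filt_dist L x y = (1/2) ^ a" "filt_dist L y z = (1/2) ^ b"
    using filt_dist_cases filt_dist_eq_0_iff by metis
  define c where "c = min a b"
  have "y - x \<in> L c" "z - y \<in> L c"
    using ab filt_dist_le_iff filt_antimono[of c] unfolding c_def
    by (metis (no_types, lifting) order_refl in_mono min.cobounded1 min.cobounded2)+
  then have "(z - y) + (y - x) \<in> L c"
    using subspace_add[OF filt_subspace] by blast
  then have "filt_dist L x z \<le> (1/2) ^ c"
    by (simp add: filt_dist_le_iff)
  also have "\<dots> \<le> max (filt_dist L x y) (filt_dist L y z)"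
    unfolding c_def ab by (cases "a \<le> b") (auto simp: min_def)
  finally show ?thesis .
qed

sublocale metric: Metric_space UNIV "filt_dist L"
proof
  fix x y z
  show "filt_dist L x z \<le> filt_dist L x y + filt_dist L y z"
    using filt_dist_ultrametric[of x z y] filt_dist_nonneg[of x y] filt_dist_nonneg[of y z]
    by simp
qed (auto simp: filt_dist_nonneg filt_dist_commute filt_dist_eq_0_iff)

end

locale complete_filtered_lie_algebra = filtered_lie_algebra +
  assumes filt_complete: "metric.mcomplete"

subsection \<open>Formally convergent series\<close>

definition formally_convergent :: "(nat \<Rightarrow> 'a set) \<Rightarrow> ('i \<Rightarrow> 'a) \<Rightarrow> 'i set \<Rightarrow> bool" where
  "formally_convergent L f I \<longleftrightarrow> (\<forall>m. finite {i \<in> I. f i \<notin> L m})"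

text \<open>The value of a series is the limit of its finite partial sums for the distance
  \<^const>\<open>filt_dist\<close>.\<close>

definition has_formal_sum ::
  "(nat \<Rightarrow> 'a::ab_group_add set) \<Rightarrow> ('i \<Rightarrow> 'a) \<Rightarrow> 'i set \<Rightarrow> 'a \<Rightarrow> bool" where
  "has_formal_sum L f I s \<longleftrightarrow> formally_convergent L f I \<and>
     limitin (Metric_space.mtopology UNIV (filt_dist L)) (sum f) s (finite_subsets_at_top I)"

definition formal_sum :: "(nat \<Rightarrow> 'a::ab_group_add set) \<Rightarrow> ('i \<Rightarrow> 'a) \<Rightarrow> 'i set \<Rightarrow> 'a" where
  "formal_sum L f I = (THE s. has_formal_sum L f I s)"

lemma (in filtered_lie_algebra) has_formal_sum_unique:
  assumes "has_formal_sum L f I s" "has_formal_sum L f I t"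
  shows "s = t"
  using assms metric.Hausdorff_space_mtopology
  unfolding has_formal_sum_def
  by (meson limitin_Hausdorff_unique finite_subsets_at_top_neq_bot)

lemma (in filtered_lie_algebra) formal_sum_eq:
  "has_formal_sum L f I s \<Longrightarrow> formal_sum L f I = s"
  unfolding formal_sum_def using has_formal_sum_unique by blast

subsection \<open>The splitting of the field of formal Laurent series\<close>

definition pi_plus :: "'k::field fls \<Rightarrow> 'k fls" where
  "pi_plus f = fps_to_fls (fls_regpart f)"

definition pi_minus :: "'k::field fls \<Rightarrow> 'k fls" where
  "pi_minus f = f - pi_plus f"

lemma pi_plus_nth: "fls_nth (pi_plus f) n = (if n \<ge> 0 then fls_nth f n else 0)"
  unfolding pi_plus_def by simp

lemma pi_minus_nth: "fls_nth (pi_minus f) n = (if n < 0 then fls_nth f n else 0)"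
  unfolding pi_minus_def by (simp add: pi_plus_nth)

subsection \<open>The coefficients\<close>

definition T_coeff :: "('n \<Rightarrow> 'k::field) \<Rightarrow> 'n list \<Rightarrow> 'k fls" where
  "T_coeff \<phi> w = 1 / (\<Prod>i=1..length w.
     fls_const (sum_list (map \<phi> (take i w))) + of_nat i * fls_X)"

function U_minus :: "('n \<Rightarrow> 'k::field) \<Rightarrow> 'n list \<Rightarrow> 'k fls" where
  "U_minus \<phi> w = (if w = [] then 1
     else - pi_minus (\<Sum>i\<in>{..<length w}. U_minus \<phi> (take i w) * T_coeff \<phi> (drop i w)))"
  by auto
termination by (relation "Wellfounded.measure (\<lambda>(\<phi>, w). length w)") auto

declare U_minus.simps [simp del]

definition D_coeff :: "('n \<Rightarrow> 'k::field) \<Rightarrow> 'n list \<Rightarrow> 'k fls" where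
  "D_coeff \<phi> w = (\<Sum>i<length w. U_minus \<phi> (take i w) * T_coeff \<phi> (drop i w))"

definition U_plus :: "('n \<Rightarrow> 'k::field) \<Rightarrow> 'n list \<Rightarrow> 'k fls" where
  "U_plus \<phi> w = (if w = [] then 1 else pi_plus (D_coeff \<phi> w))"

lemma U_minus_Nil: "U_minus \<phi> [] = 1"
  by (simp add: U_minus.simps)

lemma U_minus_nonempty: "w \<noteq> [] \<Longrightarrow> U_minus \<phi> w = - pi_minus (D_coeff \<phi> w)"
  by (subst U_minus.simps) (simp add: D_coeff_def)

lemma D_coeff_eq:
  "D_coeff \<phi> w = (\<Sum>(a, b)\<in>{(a, b). w = a @ b \<and> b \<noteq> []}. U_minus \<phi> a * T_coeff \<phi> b)"
  unfolding D_coeff_def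
  by (rule sum.reindex_bij_witness[where i = "\<lambda>(a, b). length a" and j = "\<lambda>i. (take i w, drop i w)"])
    auto

definition R_coeff :: "('n \<Rightarrow> 'k::field) \<Rightarrow> 'n list \<Rightarrow> 'k" where
  "R_coeff \<phi> w = - of_nat (length w) * fls_residue (U_minus \<phi> w)"

definition S_coeff :: "('n \<Rightarrow> 'k::field) \<Rightarrow> 'n list \<Rightarrow> 'k" where
  "S_coeff \<phi> w = fls_nth (U_plus \<phi> w) 0"

subsection \<open>The normal form and the normalizing automorphism\<close>

text \<open>The value on the empty word is a dummy: only nonempty words are summed in \<open>normal_form\<close>.\<close>

fun nested_bracket :: "('a::zero \<Rightarrow> 'a \<Rightarrow> 'a) \<Rightarrow> ('n \<Rightarrow> 'a) \<Rightarrow> 'n list \<Rightarrow> 'a" where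
  "nested_bracket bracket b [] = 0"
| "nested_bracket bracket b [n] = b n"
| "nested_bracket bracket b (n # w) = bracket (b n) (nested_bracket bracket b w)"

definition normal_form_term ::
  "('k::field \<Rightarrow> 'a::ab_group_add \<Rightarrow> 'a) \<Rightarrow> ('a \<Rightarrow> 'a \<Rightarrow> 'a) \<Rightarrow> ('n \<Rightarrow> 'k) \<Rightarrow> ('n \<Rightarrow> 'a) \<Rightarrow>
    'n list \<Rightarrow> 'a" where
  "normal_form_term smul bracket \<phi> b w =
     smul (1 / of_nat (length w) * R_coeff \<phi> w) (nested_bracket bracket b w)"

definition normalizer_term ::
  "('k::field \<Rightarrow> 'a::ab_group_add \<Rightarrow> 'a) \<Rightarrow> ('a \<Rightarrow> 'a \<Rightarrow> 'a) \<Rightarrow> ('n \<Rightarrow> 'k) \<Rightarrow> ('n \<Rightarrow> 'a) \<Rightarrow>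
    'a \<Rightarrow> 'n list \<Rightarrow> 'a" where
  "normalizer_term smul bracket \<phi> b x w =
     smul (S_coeff \<phi> w) (foldr (\<lambda>n. bracket (b n)) w x)"

definition normal_form ::
  "('k::field \<Rightarrow> 'a::ab_group_add \<Rightarrow> 'a) \<Rightarrow> ('a \<Rightarrow> 'a \<Rightarrow> 'a) \<Rightarrow> (nat \<Rightarrow> 'a set) \<Rightarrow>
    ('n \<Rightarrow> 'k) \<Rightarrow> ('n \<Rightarrow> 'a) \<Rightarrow> 'n set \<Rightarrow> 'a" where
  "normal_form smul bracket L \<phi> b Idx =
     formal_sum L (normal_form_term smul bracket \<phi> b) (lists Idx - {[]})"

definition normalizer ::
  "('k::field \<Rightarrow> 'a::ab_group_add \<Rightarrow> 'a) \<Rightarrow> ('a \<Rightarrow> 'a \<Rightarrow> 'a) \<Rightarrow> (nat \<Rightarrow> 'a set) \<Rightarrow>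
    ('n \<Rightarrow> 'k) \<Rightarrow> ('n \<Rightarrow> 'a) \<Rightarrow> 'n set \<Rightarrow> 'a \<Rightarrow> 'a" where
  "normalizer smul bracket L \<phi> b Idx x =
     formal_sum L (normalizer_term smul bracket \<phi> b x) (lists Idx)"

end

theory Submission
  imports Defs
begin

text \<open>Give a word \<open>w\<close> the weight \<open>\<phi> w + r w \<epsilon>\<close>; weights define a derivation \<open>\<nabla>\<close> of the algebra of
  moulds. Since \<open>\<nabla> T = T I\<close>, with \<open>I\<close> the indicator of one-letter words, \<open>T\<close> is symmetral, and hence
  so are the two factors in \<open>U\<^sub>+ = U\<^sub>- T\<close>: the defects of symmetrality of \<open>U\<^sub>+\<close> and \<open>U\<^sub>-\<close> agree, and one
  is regular, the other polar. In the same way \<open>\<nabla> U\<^sub>- = - R U\<^sub>-\<close> and \<open>\<nabla> U\<^sub>+ = U\<^sub>+ I - R U\<^sub>+\<close>, whose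
  constant term is the mould equation \<open>\<phi> S = S I - R S\<close>; the first equation also shows that \<open>R\<close>
  vanishes on words with \<open>\<phi> w \<noteq> 0\<close>, whence \<open>[X\<^sub>0, N] = 0\<close>.

  Symmetrality of \<open>S\<close> makes \<open>\<Psi>\<close> compatible with brackets, and with the mould equation it gives
  \<open>ad (\<Psi> (X\<^sub>0 + B)) = ad X\<^sub>0 + \<Sum> R\<^sup>w ad\<^sub>w\<close>. To recover \<open>\<Psi> (X\<^sub>0 + B)\<close> itself in spite of a possible
  centre, one applies both sides to a formal element acting as the derivation that multiplies words
  by their length. This is where the factor \<open>1/r\<close> in \<open>N\<close> comes from.\<close>

subsection \<open>Shuffles and products of moulds\<close>

text \<open>The sum runs over shuffles with multiplicity, unlike the set \<^const>\<open>shuffles\<close>.\<close>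

fun shuffle_sum :: "('n list \<Rightarrow> 'c::comm_monoid_add) \<Rightarrow> 'n list \<Rightarrow> 'n list \<Rightarrow> 'c" where
  "shuffle_sum M [] v = M v"
| "shuffle_sum M (a # u) [] = M (a # u)"
| "shuffle_sum M (a # u) (b # v) =
     shuffle_sum (\<lambda>w. M (a # w)) u (b # v) + shuffle_sum (\<lambda>w. M (b # w)) (a # u) v"

lemma shuffle_sum_Nil2 [simp]: "shuffle_sum M u [] = M u"
  by (cases u) auto

lemma shuffle_sum_cong:
  assumes "\<And>w. mset w = mset u + mset v \<Longrightarrow> M w = M' w"
  shows "shuffle_sum M u v = shuffle_sum M' u v"
  using assms
proof (induction M u v arbitrary: M' rule: shuffle_sum.induct)
  case (3 M a u b v)
  have "shuffle_sum (\<lambda>w. M (a # w)) u (b # v) = shuffle_sum (\<lambda>w. M' (a # w)) u (b # v)"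
    by (rule 3(1), rule 3(3)) simp
  moreover have "shuffle_sum (\<lambda>w. M (b # w)) (a # u) v = shuffle_sum (\<lambda>w. M' (b # w)) (a # u) v"
    by (rule 3(2), rule 3(3)) simp
  ultimately show ?case by simp
qed simp_all

lemma shuffle_sum_add:
  "shuffle_sum (\<lambda>w. M w + M' w) u v = shuffle_sum M u v + shuffle_sum M' u v"
proof (induction M u v arbitrary: M' rule: shuffle_sum.induct)
  case (3 M a u b v)
  show ?case
    using 3(1)[of "\<lambda>w. M' (a # w)"] 3(2)[of "\<lambda>w. M' (b # w)"] by (simp add: ac_simps)
qed simp_all

lemma shuffle_sum_mult_left:
  fixes M :: "'n list \<Rightarrow> 'c::semiring_0"
  shows "shuffle_sum (\<lambda>w. c * M w) u v = c * shuffle_sum M u v"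
  by (induction M u v rule: shuffle_sum.induct) (simp_all add: distrib_left)

lemma shuffle_sum_closed:
  assumes "\<And>x y. x \<in> A \<Longrightarrow> y \<in> A \<Longrightarrow> x + y \<in> A"
    and "\<And>w. mset w = mset u + mset v \<Longrightarrow> M w \<in> A"
  shows "shuffle_sum M u v \<in> A"
  using assms(2)
proof (induction M u v rule: shuffle_sum.induct)
  case (3 M a u b v)
  have "shuffle_sum (\<lambda>w. M (a # w)) u (b # v) \<in> A"
    by (rule 3(1), rule 3(3)) simp
  moreover have "shuffle_sum (\<lambda>w. M (b # w)) (a # u) v \<in> A"
    by (rule 3(2), rule 3(3)) simp
  ultimately show ?case by (simp add: assms(1))
qed simp_all

text \<open>The recursion of \<open>shuffle_sum\<close> peels off first letters, whereas
  \<open>T_coeff\<close> satisfies a recursion on the last letter. Reversing words preserves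
  shuffles, so the same rule holds at the other end.\<close>

lemma shuffle_sum_snoc:
  "shuffle_sum M (u @ [a]) (v @ [b]) =
     shuffle_sum (\<lambda>w. M (w @ [a])) u (v @ [b]) + shuffle_sum (\<lambda>w. M (w @ [b])) (u @ [a]) v"
proof (induction M u v rule: shuffle_sum.induct)
  case (1 M v)
  then show ?case
    by (induction v arbitrary: M) (simp_all add: ac_simps)
next
  case (2 M c u)
  then show ?case
  proof (induction u arbitrary: M c)
    case (Cons d u)
    then show ?case
      using Cons[of "\<lambda>w. M (c # w)" d] by (simp add: ac_simps)
  qed (simp add: ac_simps)
next
  case (3 M c u d v)
  then show ?case by (simp add: ac_simps)
qed

lemma shuffle_sum_heads:
  "u \<noteq> [] \<or> v \<noteq> [] \<Longrightarrow> shuffle_sum M u v =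
     (case u of [] \<Rightarrow> 0 | a # u' \<Rightarrow> shuffle_sum (\<lambda>w. M (a # w)) u' v) +
     (case v of [] \<Rightarrow> 0 | b # v' \<Rightarrow> shuffle_sum (\<lambda>w. M (b # w)) u v')"
  by (cases u; cases v) simp_all

section \<open>The concatenation product of moulds\<close>

definition mould_mult :: "('n list \<Rightarrow> 'c) \<Rightarrow> ('n list \<Rightarrow> 'c) \<Rightarrow> 'n list \<Rightarrow> 'c::comm_ring_1" where
  "mould_mult A B w = (\<Sum>i\<le>length w. A (take i w) * B (drop i w))"

lemma mould_mult_Nil [simp]: "mould_mult A B [] = A [] * B []"
  by (simp add: mould_mult_def)

lemma mould_mult_Cons:
  "mould_mult A B (n # w) = A [] * B (n # w) + mould_mult (\<lambda>x. A (n # x)) B w"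
  by (simp add: mould_mult_def sum.atMost_Suc_shift del: sum.atMost_Suc)

lemma mould_mult_add_left: "mould_mult (\<lambda>w. A w + A' w) B w = mould_mult A B w + mould_mult A' B w"
  by (simp add: mould_mult_def distrib_right sum.distrib)

lemma mould_mult_scale_left: "mould_mult (\<lambda>w. c * A w) B w = c * mould_mult A B w"
  by (simp add: mould_mult_def sum_distrib_left mult.assoc)

lemma mould_mult_assoc: "mould_mult (mould_mult A B) C w = mould_mult A (mould_mult B C) w"
  by (induction w arbitrary: A B)
    (simp_all add: mould_mult_Cons mould_mult_add_left mould_mult_scale_left algebra_simps)

lemma mould_mult_last:
  "mould_mult A B w = A w * B [] + (\<Sum>i<length w. A (take i w) * B (drop i w))"
  by (simp add: mould_mult_def lessThan_Suc_atMost[symmetric] add.commute)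

text \<open>Both parts of a cut contribute additively to \<open>d\<close>, so multiplication by
  \<open>d\<close> obeys the Leibniz rule. It is applied with \<open>weight\<close> as
  \<open>d\<close>.\<close>

lemma mould_mult_derivation:
  assumes "\<And>x y. d (x @ y) = d x + d y"
  shows "d w * mould_mult A B w =
    mould_mult (\<lambda>x. d x * A x) B w + mould_mult A (\<lambda>x. d x * B x) w"
proof -
  have "d w * (A (take i w) * B (drop i w)) =
      d (take i w) * A (take i w) * B (drop i w) + A (take i w) * (d (drop i w) * B (drop i w))" for i
    using assms[of "take i w" "drop i w"] by (simp add: algebra_simps)
  then show ?thesis
    by (simp add: mould_mult_def sum_distrib_left sum.distrib)
qed

definition letter_mould :: "'n list \<Rightarrow> 'c::comm_ring_1" where
  "letter_mould w = (if length w = 1 then 1 else 0)"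

lemma mould_mult_letter: "mould_mult A letter_mould w = (if w = [] then 0 else A (butlast w))"
proof (cases w rule: rev_cases)
  case (snoc v n)
  have "(\<Sum>i\<le>length w. A (take i w) * letter_mould (drop i w)) =
      (\<Sum>i\<in>{length v}. A (take i w) * letter_mould (drop i w))"
    using snoc by (intro sum.mono_neutral_right) (auto simp: letter_mould_def)
  then show ?thesis
    using snoc by (simp add: mould_mult_def letter_mould_def)
qed (simp add: letter_mould_def)

text \<open>Shuffling is compatible with deconcatenation: a cut of a shuffle of \<open>u\<close> and
  \<open>v\<close> cuts \<open>u\<close> and \<open>v\<close> separately, shuffling the prefixes and
  the suffixes. In the induction either the prefix is empty, or its first letter is absorbed into
  \<open>A\<close>.\<close>

lemma shuffle_sum_mould_mult:
  "shuffle_sum (mould_mult A B) u v =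
     (\<Sum>i\<le>length u. \<Sum>j\<le>length v.
        shuffle_sum A (take i u) (take j v) * shuffle_sum B (drop i u) (drop j v))"
proof (induction "length u + length v" arbitrary: A u v rule: less_induct)
  case less
  let ?X = "\<lambda>A u v i j. shuffle_sum A (take i u) (take j v) * shuffle_sum B (drop i u) (drop j v)"
  show ?case
  proof (cases "u = [] \<or> v = []")
    case True
    then show ?thesis by (auto simp: mould_mult_def)
  next
    case False
    then obtain a u' b v' where uv: "u = a # u'" "v = b # v'"
      by (metis list.exhaust)
    let ?Aa = "\<lambda>x. A (a # x)" and ?Ab = "\<lambda>x. A (b # x)"
    have "shuffle_sum (mould_mult A B) u v =
        A [] * shuffle_sum B u v + (shuffle_sum (mould_mult ?Aa B) u' v
          + shuffle_sum (mould_mult ?Ab B) u v')"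
      by (simp add: uv mould_mult_Cons shuffle_sum_add shuffle_sum_mult_left algebra_simps)
    also have "shuffle_sum (mould_mult ?Aa B) u' v = (\<Sum>i\<le>length u'. \<Sum>j\<le>length v. ?X ?Aa u' v i j)"
      by (rule less) (simp add: uv)
    also have "shuffle_sum (mould_mult ?Ab B) u v' = (\<Sum>i\<le>length u. \<Sum>j\<le>length v'. ?X ?Ab u v' i j)"
      by (rule less) (simp add: uv)
    finally show ?thesis
      by (simp add: uv sum.atMost_Suc_shift sum.distrib distrib_right algebra_simps del: sum.atMost_Suc)
  qed
qed

definition symmetral :: "('n list \<Rightarrow> 'c::comm_ring_1) \<Rightarrow> bool" where
  "symmetral M \<longleftrightarrow> M [] = 1 \<and> (\<forall>u v. shuffle_sum M u v = M u * M v)"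

subsection \<open>The Birkhoff decomposition of the mould T\<close>

definition regular :: "'k::field fls \<Rightarrow> bool" where
  "regular f \<longleftrightarrow> (\<forall>n<0. fls_nth f n = 0)"

definition polar :: "'k::field fls \<Rightarrow> bool" where
  "polar f \<longleftrightarrow> (\<forall>n\<ge>0. fls_nth f n = 0)"

lemma regular_iff: "regular f \<longleftrightarrow> f = fps_to_fls (fls_regpart f)"
  unfolding regular_def by (auto simp: fls_eq_iff)

lemma regular_mult: "regular f \<Longrightarrow> regular g \<Longrightarrow> regular (f * g)"
  and regular_mult_nth_0:
    "regular f \<Longrightarrow> regular g \<Longrightarrow> fls_nth (f * g) 0 = fls_nth f 0 * fls_nth g 0"
proof -
  assume "regular f" "regular g"
  then have "f * g = fps_to_fls (fls_regpart f) * fps_to_fls (fls_regpart g)"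
    by (metis regular_iff)
  then have *: "f * g = fps_to_fls (fls_regpart f * fls_regpart g)"
    by (simp add: fls_times_fps_to_fls)
  then show "regular (f * g)"
    by (simp add: regular_def)
  show "fls_nth (f * g) 0 = fls_nth f 0 * fls_nth g 0"
    unfolding * by simp
qed

lemma regular_add: "regular f \<Longrightarrow> regular g \<Longrightarrow> regular (f + g)"
  and regular_diff: "regular f \<Longrightarrow> regular g \<Longrightarrow> regular (f - g)"
  and regular_sum: "(\<And>i. i \<in> I \<Longrightarrow> regular (h i)) \<Longrightarrow> regular (sum h I)"
  and regular_const: "regular (fls_const c)"
  and regular_1: "regular 1"
  and regular_0: "regular 0"
  by (simp_all add: regular_def fls_nth_sum fls_const_nth)

lemma polar_add: "polar f \<Longrightarrow> polar g \<Longrightarrow> polar (f + g)"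
  and polar_diff: "polar f \<Longrightarrow> polar g \<Longrightarrow> polar (f - g)"
  and polar_sum: "(\<And>i. i \<in> I \<Longrightarrow> polar (h i)) \<Longrightarrow> polar (sum h I)"
  by (simp_all add: polar_def fls_nth_sum)

lemma polar_mult:
  assumes "polar f" "polar g"
  shows "polar (f * g)"
  unfolding polar_def
proof (intro allI impI)
  fix n :: int
  assume "n \<ge> 0"
  then have "fls_nth f i = 0 \<or> fls_nth g (n - i) = 0" for i
    using assms unfolding polar_def by (cases "i \<ge> 0") auto
  \<comment> \<open>These shifted indices are the ones in which \<open>fls_times_nth\<close> writes
    the convolution, with \<open>k\<close> the subdegree of \<open>g\<close>.\<close>
  moreover have "fls_nth f (i - k) = 0 \<or> fls_nth g (k + n - i) = 0" for i k
    using calculation[of "i - k"] by (simp add: algebra_simps)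
  ultimately show "fls_nth (f * g) n = 0"
    by (auto simp: fls_times_nth(1) intro!: sum.neutral)
qed

lemma regular_polar_0: "regular f \<Longrightarrow> polar f \<Longrightarrow> f = 0"
  unfolding regular_def polar_def fls_eq_iff by (metis not_le fls_zero_nth)

lemma regular_pi_plus: "regular (pi_plus f)"
  and polar_pi_minus: "polar (pi_minus f)"
  by (simp_all add: regular_def polar_def pi_plus_nth pi_minus_nth)

text \<open>The eigenvalue of ad \<open>X\<^sub>0\<close> on brackets of the letters of
  \<open>w\<close>, deformed by \<epsilon> times the length. The denominator of
  \<open>T_coeff\<close> is the product of the weights of the nonempty prefixes.\<close>

definition weight :: "('n \<Rightarrow> 'k::field) \<Rightarrow> 'n list \<Rightarrow> 'k fls" where
  "weight \<phi> w = fls_const (sum_list (map \<phi> w)) + of_nat (length w) * fls_X"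

lemma weight_append: "weight \<phi> (u @ v) = weight \<phi> u + weight \<phi> v"
  by (simp add: weight_def fls_plus_const algebra_simps)

lemma weight_Nil [simp]: "weight \<phi> [] = 0"
  by (simp add: weight_def)

lemma weight_times_nth:
  "fls_nth (weight \<phi> w * f) n = sum_list (map \<phi> w) * fls_nth f n + of_nat (length w) * fls_nth f (n - 1)"
  by (simp add: weight_def distrib_right mult.assoc fls_X_times_conv_shift(1))

lemma regular_weight: "regular (weight \<phi> w)"
  by (simp add: regular_def weight_def fls_const_nth)

text \<open>The coefficient of \<epsilon> is the length, nonzero in characteristic 0. The
  deformation thus removes all resonances.\<close>

lemma weight_nonzero:
  fixes \<phi> :: "'n \<Rightarrow> 'k::field_char_0"
  assumes "w \<noteq> []"
  shows "weight \<phi> w \<noteq> 0"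
proof
  assume "weight \<phi> w = 0"
  then have "fls_nth (weight \<phi> w * 1) 1 = 0"
    by simp
  then show False
    unfolding weight_times_nth using assms by simp
qed

lemma weight_mset: "mset w = mset w' \<Longrightarrow> weight \<phi> w = weight \<phi> w'"
  unfolding weight_def by (metis mset_map sum_mset_sum_list size_mset)

section \<open>The mould T and its differential equation\<close>

lemma T_coeff_Nil [simp]: "T_coeff \<phi> [] = 1"
  by (simp add: T_coeff_def)

lemma T_coeff_snoc:
  fixes \<phi> :: "'n \<Rightarrow> 'k::field_char_0"
  shows "weight \<phi> (w @ [n]) * T_coeff \<phi> (w @ [n]) = T_coeff \<phi> w"
proof -
  let ?h = "\<lambda>w i. fls_const (sum_list (map \<phi> (take i w))) + of_nat i * fls_X"
  have "(\<Prod>i=1..length (w @ [n]). ?h (w @ [n]) i) = (\<Prod>i=1..length w. ?h (w @ [n]) i) * weight \<phi> (w @ [n])"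
    by (simp add: weight_def)
  also have "(\<Prod>i=1..length w. ?h (w @ [n]) i) = (\<Prod>i=1..length w. ?h w i)"
    by (intro prod.cong) auto
  finally have "T_coeff \<phi> (w @ [n]) = 1 / ((\<Prod>i=1..length w. ?h w i) * weight \<phi> (w @ [n]))"
    unfolding T_coeff_def by (simp only:)
  moreover have "T_coeff \<phi> w = 1 / (\<Prod>i=1..length w. ?h w i)"
    by (simp only: T_coeff_def)
  ultimately show ?thesis
    using weight_nonzero[of "w @ [n]" \<phi>] by (simp only:) simp
qed

lemma weight_T_coeff:
  fixes \<phi> :: "'n \<Rightarrow> 'k::field_char_0"
  shows "weight \<phi> w * T_coeff \<phi> w = mould_mult (T_coeff \<phi>) letter_mould w"
proof (cases w rule: rev_cases)
  case (snoc v n)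
  then show ?thesis by (simp add: mould_mult_letter T_coeff_snoc)
qed (simp add: letter_mould_def)

text \<open>After multiplication by \<open>weight \<phi> (u @ v)\<close>, which is constant over all
  shuffles and nonzero, both sides satisfy the same recursion on last letters.\<close>

lemma symmetral_T_coeff:
  fixes \<phi> :: "'n \<Rightarrow> 'k::field_char_0"
  shows "symmetral (T_coeff \<phi>)"
proof -
  have "shuffle_sum (T_coeff \<phi>) u v = T_coeff \<phi> u * T_coeff \<phi> v" for u v
  proof (induction "length u + length v" arbitrary: u v rule: less_induct)
    case less
    show ?case
    proof (cases "u = [] \<or> v = []")
      case False
      then obtain u' a v' b where uv: "u = u' @ [a]" "v = v' @ [b]"
        by (metis rev_exhaust)
      have "weight \<phi> (u @ v) * shuffle_sum (T_coeff \<phi>) u v =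
          shuffle_sum (\<lambda>w. weight \<phi> w * T_coeff \<phi> w) u v"
        unfolding shuffle_sum_mult_left[symmetric]
        by (rule shuffle_sum_cong) (metis mset_append weight_mset)
      also have "\<dots> = shuffle_sum (T_coeff \<phi>) u' v + shuffle_sum (T_coeff \<phi>) u v'"
        unfolding uv by (simp add: shuffle_sum_snoc T_coeff_snoc)
      also have "\<dots> = T_coeff \<phi> u' * T_coeff \<phi> v + T_coeff \<phi> u * T_coeff \<phi> v'"
        using less[of u' v] less[of u v'] by (simp add: uv)
      \<comment> \<open>Each shortened factor is the full one times the weight of its word, and the
        two weights add up.\<close>
      also have "\<dots> = weight \<phi> (u @ v) * (T_coeff \<phi> u * T_coeff \<phi> v)"
        unfolding weight_append uv T_coeff_snoc[of \<phi> u' a, symmetric] T_coeff_snoc[of \<phi> v' b, symmetric]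
        by (simp add: algebra_simps)
      finally show ?thesis
        using weight_nonzero[of "u @ v" \<phi>] False by simp
    qed auto
  qed
  then show ?thesis by (simp add: symmetral_def)
qed

text \<open>\<open>D_coeff\<close> omits the cut with empty second part, which is
  \<open>U_minus \<phi> w\<close> itself. Restoring it turns \<open>D\<close> into
  \<open>D - pi_minus D = pi_plus D\<close>.\<close>

lemma U_plus_eq_mult: "U_plus \<phi> w = mould_mult (U_minus \<phi>) (T_coeff \<phi>) w"
proof (cases "w = []")
  case False
  then show ?thesis
    by (simp add: mould_mult_last U_plus_def U_minus_nonempty pi_minus_def D_coeff_def)
qed (simp add: U_plus_def U_minus_Nil)

lemma polar_U_minus: "w \<noteq> [] \<Longrightarrow> polar (U_minus \<phi> w)"
  using polar_pi_minus[of "D_coeff \<phi> w"] by (simp add: U_minus_nonempty polar_def)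

lemma regular_U_plus: "regular (U_plus \<phi> w)"
  by (simp add: U_plus_def regular_1 regular_pi_plus)

section \<open>Symmetrality of the Birkhoff factors\<close>

lemma symmetral_U_minus:
  fixes \<phi> :: "'n \<Rightarrow> 'k::field_char_0"
  shows "symmetral (U_minus \<phi>)"
    and symmetral_U_plus: "symmetral (U_plus \<phi>)"
proof -
  let ?U = "U_minus \<phi>" and ?V = "U_plus \<phi>" and ?T = "T_coeff \<phi>"
  have V: "U_plus \<phi> = mould_mult ?U ?T"
    by (rule ext) (rule U_plus_eq_mult)
  have T: "shuffle_sum ?T u v = ?T u * ?T v" for u v
    using symmetral_T_coeff[of \<phi>] by (simp add: symmetral_def)
  have prod: "?V u * ?V v = (\<Sum>i\<le>length u. \<Sum>j\<le>length v.
      (?U (take i u) * ?U (take j v)) * (?T (drop i u) * ?T (drop j v)))" for u v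
    by (simp add: V mould_mult_def sum_product ac_simps)
  have key: "shuffle_sum ?U u v = ?U u * ?U v \<and> shuffle_sum ?V u v = ?V u * ?V v" for u v
  proof (induction "length u + length v" arbitrary: u v rule: less_induct)
    case less
    show ?case
    proof (cases "u = [] \<or> v = []")
      case True
      then show ?thesis by (auto simp: U_minus_Nil U_plus_def)
    next
      case False
      let ?h = "\<lambda>i j. (shuffle_sum ?U (take i u) (take j v) - ?U (take i u) * ?U (take j v))
          * (?T (drop i u) * ?T (drop j v))"
      have "shuffle_sum ?V u v - ?V u * ?V v = (\<Sum>i\<le>length u. \<Sum>j\<le>length v. ?h i j)"
        unfolding prod by (simp add: V shuffle_sum_mould_mult T left_diff_distrib sum_subtractf)
      also have "\<dots> = (\<Sum>(i, j)\<in>{..length u} \<times> {..length v}. ?h i j)"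
        by (simp add: sum.cartesian_product)
      \<comment> \<open>Every other pair of prefixes is shorter in total, so its defect vanishes by
        induction. In the surviving term \<open>T\<close> is evaluated on empty words and equals
        1.\<close>
      also have "\<dots> = (\<Sum>(i, j)\<in>{(length u, length v)}. ?h i j)"
      proof (intro sum.mono_neutral_right ballI)
        fix p
        assume "p \<in> {..length u} \<times> {..length v} - {(length u, length v)}"
        then obtain i j where p: "p = (i, j)" "i \<le> length u" "j \<le> length v"
          "i < length u \<or> j < length v"
          by (cases p) (auto simp: le_less)
        then show "(case p of (i, j) \<Rightarrow> ?h i j) = 0"
          using less[of "take i u" "take j v"] by auto
      qed auto
      finally have eq: "shuffle_sum ?V u v - ?V u * ?V v = shuffle_sum ?U u v - ?U u * ?U v"
        by simp
      have "shuffle_sum ?V u v \<in> {f. regular f}"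
        by (rule shuffle_sum_closed) (simp_all add: regular_add regular_U_plus)
      then have "regular (shuffle_sum ?V u v - ?V u * ?V v)"
        by (simp add: regular_diff regular_mult regular_U_plus)
      \<comment> \<open>All shuffles are nonempty here; on the empty word \<open>U_minus\<close> is
        1, which is not polar.\<close>
      moreover have "shuffle_sum ?U u v \<in> {f. polar f}"
        using False by (intro shuffle_sum_closed) (auto simp: polar_add intro!: polar_U_minus)
      then have "polar (shuffle_sum ?U u v - ?U u * ?U v)"
        using False by (simp add: polar_diff polar_mult polar_U_minus)
      ultimately show ?thesis
        using eq regular_polar_0 by (metis eq_iff_diff_eq_0)
    qed
  qed
  show "symmetral ?U" "symmetral ?V"
    using key by (simp_all add: symmetral_def U_minus_Nil U_plus_def)
qed

text \<open>Taking the constant term is a ring homomorphism on regular series, so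
  \<open>S_coeff\<close> inherits the property from \<open>U_plus\<close>.\<close>

lemma symmetral_S_coeff:
  fixes \<phi> :: "'n \<Rightarrow> 'k::field_char_0"
  shows "symmetral (S_coeff \<phi>)"
proof -
  have "shuffle_sum (\<lambda>w. fls_nth (M w) 0) u v = fls_nth (shuffle_sum M u v) 0"
    for M :: "'n list \<Rightarrow> 'k fls" and u v
    by (induction M u v rule: shuffle_sum.induct) simp_all
  then show ?thesis
    using symmetral_U_plus[of \<phi>]
    by (simp add: symmetral_def S_coeff_def[abs_def] regular_mult_nth_0 regular_U_plus)
qed

section \<open>The differential equations of the Birkhoff factors\<close>

text \<open>The defects of the two equations below are \<open>Z\<close> and \<open>Y = Z \<times> T\<close>. By induction they agree on
  the word at hand, where one is polar (this fixes \<open>R\<close>) and the other regular.\<close>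

lemma weight_U_minus:
  fixes \<phi> :: "'n \<Rightarrow> 'k::field_char_0"
  shows "weight \<phi> w * U_minus \<phi> w = - mould_mult (\<lambda>w. fls_const (R_coeff \<phi> w)) (U_minus \<phi>) w"
    and weight_U_plus: "weight \<phi> w * U_plus \<phi> w = mould_mult (U_plus \<phi>) letter_mould w
      - mould_mult (\<lambda>w. fls_const (R_coeff \<phi> w)) (U_plus \<phi>) w"
proof -
  let ?U = "U_minus \<phi>" and ?V = "U_plus \<phi>" and ?T = "T_coeff \<phi>"
  let ?R = "\<lambda>w. fls_const (R_coeff \<phi> w)"
  define Z where "Z w = weight \<phi> w * ?U w + mould_mult ?R ?U w" for w
  define Y where "Y w = weight \<phi> w * ?V w - mould_mult ?V letter_mould w + mould_mult ?R ?V w" for w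
  have V: "?V = mould_mult ?U ?T"
    by (rule ext) (rule U_plus_eq_mult)
  have YZ: "Y w = mould_mult Z ?T w" for w
  proof -
    have "(\<lambda>x. weight \<phi> x * ?T x) = mould_mult ?T letter_mould"
      by (rule ext) (rule weight_T_coeff)
    then have "weight \<phi> w * ?V w = mould_mult (\<lambda>x. weight \<phi> x * ?U x) ?T w + mould_mult ?V letter_mould w"
      unfolding V by (simp add: mould_mult_derivation weight_append mould_mult_assoc)
    then show ?thesis
      unfolding Y_def Z_def[abs_def]
      by (simp add: mould_mult_add_left V mould_mult_assoc)
  qed
  have Z0: "Z w = 0" for w
  proof (induction "length w" arbitrary: w rule: less_induct)
    case less
    show ?case
    proof (cases "w = []")
      case True
      then show ?thesis by (simp add: Z_def R_coeff_def)
    next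
      case False
      have "Y w = Z w"
        unfolding YZ mould_mult_last using less by simp
      moreover have "regular (Y w)"
        unfolding Y_def mould_mult_letter mould_mult_def
        by (intro regular_add regular_diff regular_sum regular_mult regular_weight regular_const)
          (simp_all add: regular_0 regular_1 regular_U_plus letter_mould_def)
      moreover have "polar (Z w)"
      proof -
        \<comment> \<open>The constant term of the product is the length times the residue of
          \<open>U_minus\<close>, which is exactly what \<open>R_coeff\<close> cancels.\<close>
        have "polar (weight \<phi> w * ?U w + ?R w)"
          using polar_U_minus[OF False, of \<phi>]
          by (auto simp: polar_def weight_times_nth fls_const_nth R_coeff_def)
        moreover have "polar (\<Sum>i<length w. ?R (take i w) * ?U (drop i w))"
          using polar_U_minus[of "drop i w" \<phi> for i]
          by (intro polar_sum) (simp add: polar_def)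
        ultimately show ?thesis
          unfolding Z_def mould_mult_last U_minus_Nil mult_1_right add.assoc[symmetric]
          by (rule polar_add)
      qed
      ultimately show ?thesis
        using regular_polar_0 by metis
    qed
  qed
  show "weight \<phi> w * ?U w = - mould_mult ?R ?U w"
    using Z0[of w] by (simp add: Z_def eq_neg_iff_add_eq_0)
  have "Y w = 0"
    unfolding YZ by (simp add: Z0 mould_mult_def)
  then show "weight \<phi> w * ?V w = mould_mult ?V letter_mould w - mould_mult ?R ?V w"
    by (simp add: Y_def algebra_simps)
qed

lemma S_coeff_equation:
  fixes \<phi> :: "'n \<Rightarrow> 'k::field_char_0"
  shows "sum_list (map \<phi> w) * S_coeff \<phi> w =
    mould_mult (S_coeff \<phi>) letter_mould w - mould_mult (R_coeff \<phi>) (S_coeff \<phi>) w"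
proof -
  have "fls_nth (weight \<phi> w * U_plus \<phi> w) 0 = fls_nth (mould_mult (U_plus \<phi>) letter_mould w
      - mould_mult (\<lambda>w. fls_const (R_coeff \<phi> w)) (U_plus \<phi>) w) 0"
    by (simp only: weight_U_plus)
  \<comment> \<open>The \<epsilon> in the weight shifts this coefficient into the constant term, so
    only the eigenvalue part of the weight survives there.\<close>
  moreover have "fls_nth (U_plus \<phi> w) (-1) = 0"
    using regular_U_plus[of \<phi> w] by (simp add: regular_def)
  ultimately show ?thesis
    by (simp add: weight_times_nth mould_mult_letter S_coeff_def mould_mult_def[of "R_coeff \<phi>"]
        mould_mult_def[of "\<lambda>w. fls_const (R_coeff \<phi> w)"] fls_nth_sum)
qed

text \<open>In any proper cut one part is again nonresonant, so the product in
  \<open>weight_U_minus\<close> reduces by induction to the constant \<open>R\<close>. Comparing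
  negative coefficients gives a two-term recurrence with invertible leading factor, started from the
  zeros below the subdegree.\<close>

lemma U_minus_nonresonant:
  fixes \<phi> :: "'n \<Rightarrow> 'k::field_char_0"
  assumes "sum_list (map \<phi> w) \<noteq> 0"
  shows "U_minus \<phi> w = 0"
  using assms
proof (induction "length w" arbitrary: w rule: less_induct)
  case less
  let ?U = "U_minus \<phi>" and ?R = "\<lambda>w. fls_const (R_coeff \<phi> w)"
  have ne: "w \<noteq> []"
    using less.prems by auto
  have "?R (take i w) * ?U (drop i w) = 0" if "i < length w" for i
  proof (cases "i = 0")
    case True
    then show ?thesis by (simp add: R_coeff_def)
  next
    case False
    have "sum_list (map \<phi> (take i w)) + sum_list (map \<phi> (drop i w)) \<noteq> 0"
      using less.prems by (metis append_take_drop_id map_append sum_list_append)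
    then consider "sum_list (map \<phi> (take i w)) \<noteq> 0" | "sum_list (map \<phi> (drop i w)) \<noteq> 0"
      by force
    then show ?thesis
      using less.hyps[of "take i w"] less.hyps[of "drop i w"] that False
      by cases (auto simp: R_coeff_def)
  qed
  then have "(\<Sum>i<length w. ?R (take i w) * ?U (drop i w)) = 0"
    by (intro sum.neutral ballI) (simp only: lessThan_iff)
  then have "weight \<phi> w * ?U w = - ?R w"
    unfolding weight_U_minus mould_mult_last by (simp add: U_minus_Nil)
  then have *: "sum_list (map \<phi> w) * fls_nth (?U w) n + of_nat (length w) * fls_nth (?U w) (n - 1) = 0"
    if "n < 0" for n
    using that unfolding weight_times_nth[symmetric] by (simp add: fls_const_nth)
  have "fls_nth (?U w) n = 0" for n
  proof (cases "n < 0")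
    case False
    then show ?thesis
      using polar_U_minus[OF ne, of \<phi>] by (simp add: polar_def)
  next
    case True
    \<comment> \<open>Upward induction from the subdegree. The base case includes the subdegree
      itself, whose predecessor coefficient is zero.\<close>
    have "n < 0 \<Longrightarrow> fls_nth (?U w) n = 0" if "n \<le> fls_subdegree (?U w) + int k" for n k
      using that
    proof (induction k arbitrary: n)
      case (Suc k)
      then have "fls_nth (?U w) (n - 1) = 0" by simp
      then show ?case using *[of n] Suc less.prems by simp
    next
      case 0
      have "fls_nth (?U w) (n - 1) = 0" using 0 by (simp add: fls_eq0_below_subdegree)
      then show ?case using *[of n] 0 less.prems by simp
    qed
    from this[of n "nat (n - fls_subdegree (?U w))"] show ?thesis using True by simp
  qed
  then show ?case by (intro fls_eqI) simp
qed

lemma R_coeff_resonant: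
  fixes \<phi> :: "'n \<Rightarrow> 'k::field_char_0"
  shows "sum_list (map \<phi> w) * R_coeff \<phi> w = 0"
  using U_minus_nonresonant[of \<phi> w] by (auto simp: R_coeff_def)

subsection \<open>Sums over words in a Lie algebra\<close>

definition words :: "'n set \<Rightarrow> nat \<Rightarrow> 'n list set" where
  "words F r = {w. set w \<subseteq> F \<and> length w = r}"

lemma finite_words: "finite F \<Longrightarrow> finite (words F r)"
  unfolding words_def by (rule finite_lists_length_eq)

lemma words_0 [simp]: "words F 0 = {[]}"
  by (auto simp: words_def)

lemma sum_words_Suc: "(\<Sum>w\<in>words F (Suc r). f w) = (\<Sum>n\<in>F. \<Sum>w\<in>words F r. f (n # w))"
  unfolding sum.cartesian_product
  by (rule sum.reindex_bij_witness[where i = "\<lambda>(n, w). n # w" and j = "\<lambda>w. (hd w, tl w)"])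
    (auto simp: words_def length_Suc_conv)

lemma sum_words_append:
  "(\<Sum>w\<in>words F (i + j). f w) = (\<Sum>u\<in>words F i. \<Sum>v\<in>words F j. f (u @ v))"
  by (induction i arbitrary: f) (simp_all add: sum_words_Suc)

lemma sum_words_snoc:
  "(\<Sum>w\<in>words F (Suc r). f w) = (\<Sum>w\<in>words F r. \<Sum>n\<in>F. f (w @ [n]))"
  using sum_words_append[of f F r 1] by (simp add: sum_words_Suc)

lemma sum_words_split:
  "(\<Sum>w\<in>words F r. \<Sum>i\<le>r. f i (take i w) (drop i w)) =
     (\<Sum>i\<le>r. \<Sum>u\<in>words F i. \<Sum>v\<in>words F (r - i). f i u v)"
proof -
  have "(\<Sum>w\<in>words F r. f i (take i w) (drop i w)) =
      (\<Sum>u\<in>words F i. \<Sum>v\<in>words F (r - i). f i u v)" if "i \<le> r" for i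
  proof -
    have "(\<Sum>w\<in>words F (i + (r - i)). f i (take i w) (drop i w)) =
        (\<Sum>u\<in>words F i. \<Sum>v\<in>words F (r - i). f i u v)"
      unfolding sum_words_append by (intro sum.cong) (auto simp: words_def)
    then show ?thesis using that by simp
  qed
  then show ?thesis
    by (subst sum.swap) simp
qed

text \<open>The dual of \<open>shuffle_sum\<close>: every letter is sent to one of two subwords, and
  the 2^r choices for a word of length r are counted separately.\<close>

fun unshuffle_sum :: "('n list \<Rightarrow> 'n list \<Rightarrow> 'c::comm_monoid_add) \<Rightarrow> 'n list \<Rightarrow> 'c" where
  "unshuffle_sum g [] = g [] []"
| "unshuffle_sum g (n # w) =
     unshuffle_sum (\<lambda>u v. g (n # u) v) w + unshuffle_sum (\<lambda>u v. g u (n # v)) w"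

lemma unshuffle_sum_add:
  "unshuffle_sum (\<lambda>u v. g u v + g' u v) w = unshuffle_sum g w + unshuffle_sum g' w"
  by (induction w arbitrary: g g') (simp_all add: ac_simps)

lemma unshuffle_sum_hom:
  assumes "\<And>x y. h (x + y) = h x + h y"
  shows "unshuffle_sum (\<lambda>u v. h (g u v)) w = h (unshuffle_sum g w)"
  by (induction w arbitrary: g) (simp_all add: assms)

lemma unshuffle_sum_zero: "unshuffle_sum (\<lambda>u v. 0) w = 0"
  by (induction w) simp_all

lemma unshuffle_sum_Nil_left:
  "unshuffle_sum (\<lambda>u v. if u = [] then f v else 0) w = f w"
  by (induction w arbitrary: f) (simp_all add: unshuffle_sum_zero)

section \<open>Iterated brackets along words\<close>

context lie_algebra
begin

lemma bracket_zero_left [simp]: "bracket 0 x = 0"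
  using bracket_add_left[of 0 0 x] by simp

lemma bracket_zero_right [simp]: "bracket x 0 = 0"
  using bracket_add_right[of x 0 0] by simp

lemma bracket_minus_right: "bracket x (- y) = - bracket x y"
  using bracket_add_right[of x y "- y"] by (simp add: eq_neg_iff_add_eq_0 add.commute)

lemma bracket_anticommute: "bracket x y = - bracket y x"
proof -
  have "bracket (x + y) (x + y) = bracket x y + bracket y x"
    unfolding bracket_add_left bracket_add_right by (simp add: bracket_self)
  then show ?thesis
    by (simp add: bracket_self eq_neg_iff_add_eq_0)
qed

lemma bracket_diff_right: "bracket x (y - z) = bracket x y - bracket x z"
  using bracket_add_right[of x y "- z"] by (simp add: bracket_minus_right)

lemma bracket_diff_left: "bracket (x - y) z = bracket x z - bracket y z"
  using bracket_add_left[of "x - y" y z] by simp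

lemma bracket_sum_left: "bracket (\<Sum>i\<in>I. f i) x = (\<Sum>i\<in>I. bracket (f i) x)"
  by (induction I rule: infinite_finite_induct) (simp_all add: bracket_add_left)

lemma bracket_sum_right: "bracket x (\<Sum>i\<in>I. f i) = (\<Sum>i\<in>I. bracket x (f i))"
  by (induction I rule: infinite_finite_induct) (simp_all add: bracket_add_right)

lemma bracket_derivation: "bracket x (bracket y z) = bracket (bracket x y) z + bracket y (bracket x z)"
proof -
  have "bracket y (bracket z x) = - bracket y (bracket x z)"
    by (subst bracket_anticommute[of z x]) (rule bracket_minus_right)
  moreover have "bracket z (bracket x y) = - bracket (bracket x y) z"
    by (rule bracket_anticommute)
  ultimately have "bracket x (bracket y z) + - bracket y (bracket x z) + - bracket (bracket x y) z = 0"
    using jacobi[of x y z] by simp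
  then show ?thesis
    by (simp add: algebra_simps)
qed

lemma bracket_weighted_sums:
  "bracket (\<Sum>i\<in>I. smul (c i) (f i)) (\<Sum>j\<in>J. smul (d j) (g j)) =
     (\<Sum>i\<in>I. \<Sum>j\<in>J. smul (c i * d j) (bracket (f i) (g j)))"
  unfolding bracket_sum_left
  unfolding bracket_sum_right by (simp add: bracket_scale_left bracket_scale_right mult.commute)

abbreviation ad_word :: "('n \<Rightarrow> 'a) \<Rightarrow> 'n list \<Rightarrow> 'a \<Rightarrow> 'a" where
  "ad_word b w x \<equiv> foldr (\<lambda>n. bracket (b n)) w x"

lemma ad_word_add: "ad_word b w (x + y) = ad_word b w x + ad_word b w y"
  by (induction w) (simp_all add: bracket_add_right)

lemma ad_word_scale: "ad_word b w (smul c x) = smul c (ad_word b w x)"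
  by (induction w) (simp_all add: bracket_scale_right)

lemma ad_word_zero [simp]: "ad_word b w 0 = 0"
  by (induction w) simp_all

lemma ad_word_sum: "ad_word b w (\<Sum>i\<in>I. f i) = (\<Sum>i\<in>I. ad_word b w (f i))"
  by (induction I rule: infinite_finite_induct) (simp_all add: ad_word_add)

text \<open>The dummy value \<open>0\<close> on the empty word would lose the innermost letter; the
  extra term restores it, and is what makes lengths appear in
  \<open>unshuffle_sum_nested_bracket\<close>.\<close>

lemma nested_bracket_Cons:
  "nested_bracket bracket b (n # u) = bracket (b n) (nested_bracket bracket b u) + (if u = [] then b n else 0)"
  by (cases u) simp_all

lemma nested_bracket_append:
  "v \<noteq> [] \<Longrightarrow> nested_bracket bracket b (u @ v) = ad_word b u (nested_bracket bracket b v)"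
  by (induction u) (simp_all add: nested_bracket_Cons)

text \<open>The iterated Leibniz rule: each letter acts on one of the two entries of the
  bracket.\<close>

lemma unshuffle_sum_bracket:
  "unshuffle_sum (\<lambda>u v. bracket (ad_word b u x) (ad_word b v y)) w = ad_word b w (bracket x y)"
proof (induction w)
  case (Cons n w)
  have "ad_word b (n # w) (bracket x y) =
      bracket (b n) (unshuffle_sum (\<lambda>u v. bracket (ad_word b u x) (ad_word b v y)) w)"
    by (simp add: Cons)
  also have "\<dots> = unshuffle_sum (\<lambda>u v. bracket (b n) (bracket (ad_word b u x) (ad_word b v y))) w"
    by (rule unshuffle_sum_hom[symmetric]) (rule bracket_add_right)
  finally show ?case
    by (simp add: bracket_derivation[of "b n"] unshuffle_sum_add)
qed simp

text \<open>A form of the Dynkin--Specht--Wever identity: formally, it is the preceding lemma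
  with \<open>x\<close> a derivation multiplying words by their length.\<close>

lemma unshuffle_sum_nested_bracket:
  "unshuffle_sum (\<lambda>u v. bracket (nested_bracket bracket b u) (ad_word b v y)) w =
     smul (of_nat (length w)) (ad_word b w y)"
proof (induction w)
  case (Cons n w)
  let ?N = "nested_bracket bracket b"
  let ?g = "\<lambda>u v. bracket (?N u) (ad_word b v y)"
  have g: "bracket (?N (n # u)) (ad_word b v y) + bracket (?N u) (ad_word b (n # v) y) =
      bracket (b n) (?g u v) + (if u = [] then ad_word b (n # v) y else 0)" for u v
    by (simp add: nested_bracket_Cons bracket_add_left bracket_derivation[of "b n"])
  \<comment> \<open>The second sum has a single nonzero term, the unshuffle with empty first part.
    It raises the factor from \<open>length w\<close> to \<open>length w + 1\<close>.\<close>
  have "unshuffle_sum ?g (n # w) = unshuffle_sum (\<lambda>u v. bracket (b n) (?g u v)) w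
      + unshuffle_sum (\<lambda>u v. if u = [] then ad_word b (n # v) y else 0) w"
    unfolding unshuffle_sum.simps unshuffle_sum_add[symmetric] g ..
  also have "unshuffle_sum (\<lambda>u v. bracket (b n) (?g u v)) w = bracket (b n) (unshuffle_sum ?g w)"
    by (rule unshuffle_sum_hom) (rule bracket_add_right)
  finally show ?case
    unfolding unshuffle_sum_Nil_left Cons
    by (simp add: bracket_scale_right scale_left_distrib add.commute)
qed simp

text \<open>Duality of shuffles and unshuffles. Sending the first letter of \<open>w\<close> to
  \<open>u\<close> or to \<open>v\<close> corresponds to shuffles starting with the head of
  \<open>u\<close> or of \<open>v\<close>, which are collected in \<open>h1\<close> and
  \<open>h2\<close>.\<close>

lemma sum_words_unshuffle:
  "(\<Sum>w\<in>words F r. smul (M w) (unshuffle_sum g w)) =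
     (\<Sum>i\<le>r. \<Sum>u\<in>words F i. \<Sum>v\<in>words F (r - i). smul (shuffle_sum M u v) (g u v))"
proof (induction r arbitrary: M g)
  case (Suc r)
  let ?M = "\<lambda>n w. M (n # w)"
  let ?S = "\<lambda>i j h. \<Sum>u\<in>words F i. \<Sum>v\<in>words F j. h u v"
  define h1 where "h1 u v = smul (case u of [] \<Rightarrow> 0 | n # u' \<Rightarrow> shuffle_sum (?M n) u' v) (g u v)" for u v
  define h2 where "h2 u v = smul (case v of [] \<Rightarrow> 0 | n # v' \<Rightarrow> shuffle_sum (?M n) u v') (g u v)" for u v
  have "(\<Sum>w\<in>words F (Suc r). smul (M w) (unshuffle_sum g w)) =
      (\<Sum>n\<in>F. \<Sum>i\<le>r. ?S i (r - i) (\<lambda>u v. smul (shuffle_sum (?M n) u v) (g (n # u) v))) +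
      (\<Sum>n\<in>F. \<Sum>i\<le>r. ?S i (r - i) (\<lambda>u v. smul (shuffle_sum (?M n) u v) (g u (n # v))))"
    by (simp add: sum_words_Suc scale_right_distrib sum.distrib Suc)
  also have "(\<Sum>n\<in>F. \<Sum>i\<le>r. ?S i (r - i) (\<lambda>u v. smul (shuffle_sum (?M n) u v) (g (n # u) v))) =
      (\<Sum>i\<le>r. ?S (Suc i) (r - i) h1)"
    by (subst sum.swap) (simp add: sum_words_Suc h1_def)
  \<comment> \<open>The new term, at index 0, vanishes because \<open>h1\<close> is zero for empty
    \<open>u\<close>; below, \<open>h2\<close> likewise vanishes at \<open>Suc r\<close>, where
    \<open>v\<close> is empty.\<close>
  also have "\<dots> = (\<Sum>i\<le>Suc r. ?S i (Suc r - i) h1)"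
    by (simp add: sum.atMost_Suc_shift h1_def del: sum.atMost_Suc)
  also have "(\<Sum>n\<in>F. \<Sum>i\<le>r. ?S i (r - i) (\<lambda>u v. smul (shuffle_sum (?M n) u v) (g u (n # v)))) =
      (\<Sum>i\<le>r. ?S i (Suc r - i) h2)"
  proof (subst sum.swap, intro sum.cong refl)
    fix i
    assume "i \<in> {..r}"
    then have "Suc r - i = Suc (r - i)" by auto
    then show "(\<Sum>n\<in>F. ?S i (r - i) (\<lambda>u v. smul (shuffle_sum (?M n) u v) (g u (n # v)))) =
        ?S i (Suc r - i) h2"
      by (simp only: sum_words_Suc h2_def list.case) (subst sum.swap, rule sum.cong, simp_all)
  qed
  also have "\<dots> = (\<Sum>i\<le>Suc r. ?S i (Suc r - i) h2)"
    by (simp add: h2_def)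
  also have "(\<Sum>i\<le>Suc r. ?S i (Suc r - i) h1) + (\<Sum>i\<le>Suc r. ?S i (Suc r - i) h2) =
      (\<Sum>i\<le>Suc r. ?S i (Suc r - i) (\<lambda>u v. h1 u v + h2 u v))"
    by (simp only: sum.distrib)
  also have "\<dots> = (\<Sum>i\<le>Suc r. ?S i (Suc r - i) (\<lambda>u v. smul (shuffle_sum M u v) (g u v)))"
  proof (intro sum.cong refl)
    fix i u v
    assume "i \<in> {..Suc r}" "u \<in> words F i" "v \<in> words F (Suc r - i)"
    then have "u \<noteq> [] \<or> v \<noteq> []"
      by (auto simp: words_def)
    then show "h1 u v + h2 u v = smul (shuffle_sum M u v) (g u v)"
      by (simp add: h1_def h2_def shuffle_sum_heads[of u v] scale_left_distrib)
  qed
  finally show ?case .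
qed simp

end

section \<open>Operators attached to moulds, for a fixed set of letters\<close>

locale eigenletters = lie_algebra smul bracket
  for smul :: "'k::field_char_0 \<Rightarrow> 'a::ab_group_add \<Rightarrow> 'a" and bracket :: "'a \<Rightarrow> 'a \<Rightarrow> 'a" +
  fixes b :: "'n \<Rightarrow> 'a" and \<phi> :: "'n \<Rightarrow> 'k" and X\<^sub>0 :: 'a and F :: "'n set"
  assumes eigenletter: "n \<in> F \<Longrightarrow> bracket X\<^sub>0 (b n) = smul (\<phi> n) (b n)"
begin

text \<open>Everything is kept homogeneous in the number of letters, so that these identities
  involve no convergence; \<open>F\<close> is later a finite truncation of the index set.\<close>

definition op_sum :: "('n list \<Rightarrow> 'k) \<Rightarrow> nat \<Rightarrow> 'a \<Rightarrow> 'a" where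
  "op_sum M r x = (\<Sum>w\<in>words F r. smul (M w) (ad_word b w x))"

definition nested_sum :: "('n list \<Rightarrow> 'k) \<Rightarrow> nat \<Rightarrow> 'a" where
  "nested_sum M r = (\<Sum>w\<in>words F r. smul (M w) (nested_bracket bracket b w))"

lemma op_sum_0: "op_sum M 0 x = smul (M []) x"
  by (simp add: op_sum_def)

lemma nested_sum_0 [simp]: "nested_sum M 0 = 0"
  by (simp add: nested_sum_def)

lemma op_sum_add_right: "op_sum M r (x + y) = op_sum M r x + op_sum M r y"
  by (simp add: op_sum_def ad_word_add scale_right_distrib sum.distrib)

lemma op_sum_zero_right [simp]: "op_sum M r 0 = 0"
  by (simp add: op_sum_def)

lemma bracket_ad_word:
  "set w \<subseteq> F \<Longrightarrow> bracket X\<^sub>0 (ad_word b w x) =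
     ad_word b w (bracket X\<^sub>0 x) + smul (sum_list (map \<phi> w)) (ad_word b w x)"
  by (induction w)
    (simp_all add: bracket_derivation[of X\<^sub>0] eigenletter bracket_scale_left bracket_add_right
      bracket_scale_right scale_left_distrib)

lemma bracket_nested_bracket:
  "set w \<subseteq> F \<Longrightarrow> bracket X\<^sub>0 (nested_bracket bracket b w) =
     smul (sum_list (map \<phi> w)) (nested_bracket bracket b w)"
proof (induction w)
  case (Cons n w)
  then show ?case
    by (auto simp: nested_bracket_Cons bracket_derivation[of X\<^sub>0] eigenletter bracket_scale_left
      bracket_add_right bracket_scale_right scale_left_distrib scale_right_distrib)
qed simp

text \<open>The commutator with ad \<open>X\<^sub>0\<close> multiplies the operator of a word by its
  eigenvalue. This is how mould equations become operator equations.\<close>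

lemma op_sum_weight:
  "op_sum (\<lambda>w. sum_list (map \<phi> w) * M w) r x =
     bracket X\<^sub>0 (op_sum M r x) - op_sum M r (bracket X\<^sub>0 x)"
  unfolding op_sum_def bracket_sum_right sum_subtractf[symmetric]
  by (rule sum.cong) (auto simp: words_def bracket_scale_right bracket_ad_word scale_right_distrib mult.commute)

lemma nested_sum_weight:
  "nested_sum (\<lambda>w. sum_list (map \<phi> w) * M w) r = bracket X\<^sub>0 (nested_sum M r)"
  unfolding nested_sum_def bracket_sum_right
  by (rule sum.cong) (auto simp: words_def bracket_scale_right bracket_nested_bracket mult.commute)

lemma op_sum_mould_mult: "op_sum (mould_mult M M') r x = (\<Sum>i\<le>r. op_sum M i (op_sum M' (r - i) x))"
proof -
  have "op_sum (mould_mult M M') r x = (\<Sum>w\<in>words F r. \<Sum>i\<le>r.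
      smul (M (take i w) * M' (drop i w)) (ad_word b (take i w) (ad_word b (drop i w) x)))"
    unfolding op_sum_def
    by (intro sum.cong refl)
      (simp add: words_def mould_mult_def scale_sum_left foldr_append[symmetric] del: foldr_append)
  also have "\<dots> = (\<Sum>i\<le>r. \<Sum>u\<in>words F i. \<Sum>v\<in>words F (r - i).
      smul (M u * M' v) (ad_word b u (ad_word b v x)))"
    by (rule sum_words_split)
  finally show ?thesis
    by (simp add: op_sum_def ad_word_sum ad_word_scale scale_sum_right)
qed

text \<open>The cut with empty second part stands apart because the value of
  \<open>nested_bracket\<close> there is a dummy: \<open>nested_bracket_append\<close> fails for it.
  This produces the isolated \<open>N\<close> in \<open>nested_sum_equation\<close>.\<close>

lemma nested_sum_mould_mult:
  "nested_sum (mould_mult M M') r =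
     (\<Sum>i<r. op_sum M i (nested_sum M' (r - i))) + smul (M' []) (nested_sum M r)"
proof -
  let ?N = "nested_bracket bracket b"
  have "nested_sum (mould_mult M M') r = (\<Sum>w\<in>words F r. \<Sum>i\<le>r.
      smul (M (take i w) * M' (drop i w)) (?N (take i w @ drop i w)))"
    unfolding nested_sum_def
    by (intro sum.cong refl) (simp add: words_def mould_mult_def scale_sum_left)
  also have "\<dots> = (\<Sum>i\<le>r. \<Sum>u\<in>words F i. \<Sum>v\<in>words F (r - i). smul (M u * M' v) (?N (u @ v)))"
    by (rule sum_words_split)
  also have "\<dots> = (\<Sum>i<r. \<Sum>u\<in>words F i. \<Sum>v\<in>words F (r - i). smul (M u * M' v) (?N (u @ v)))
      + (\<Sum>u\<in>words F r. smul (M u * M' []) (?N u))"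
    by (simp add: lessThan_Suc_atMost[symmetric])
  also have "(\<Sum>i<r. \<Sum>u\<in>words F i. \<Sum>v\<in>words F (r - i). smul (M u * M' v) (?N (u @ v))) =
      (\<Sum>i<r. op_sum M i (nested_sum M' (r - i)))"
  proof (rule sum.cong)
    fix i
    assume "i \<in> {..<r}"
    then have "?N (u @ v) = ad_word b u (?N v)" if "v \<in> words F (r - i)" for u v
      using that by (intro nested_bracket_append) (auto simp: words_def)
    then show "(\<Sum>u\<in>words F i. \<Sum>v\<in>words F (r - i). smul (M u * M' v) (?N (u @ v))) =
        op_sum M i (nested_sum M' (r - i))"
      by (simp add: op_sum_def nested_sum_def ad_word_sum ad_word_scale scale_sum_right)
  qed simp
  finally show ?thesis
    by (simp add: nested_sum_def scale_sum_right mult.commute)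
qed

lemma op_sum_letter:
  "op_sum (mould_mult M letter_mould) (Suc r) x = op_sum M r (bracket (\<Sum>n\<in>F. b n) x)"
  by (simp add: op_sum_def sum_words_snoc mould_mult_letter bracket_sum_left ad_word_sum scale_sum_right)

lemma nested_sum_letter:
  "nested_sum (mould_mult M letter_mould) (Suc r) = op_sum M r (\<Sum>n\<in>F. b n)"
  by (simp add: op_sum_def nested_sum_def sum_words_snoc mould_mult_letter nested_bracket_append
    ad_word_sum scale_sum_right)

text \<open>Symmetrality factorizes the coefficients that \<open>sum_words_unshuffle\<close>
  attaches to the Leibniz rule.\<close>

lemma op_sum_bracket:
  assumes "symmetral M"
  shows "op_sum M r (bracket x y) = (\<Sum>i\<le>r. bracket (op_sum M i x) (op_sum M (r - i) y))"
proof -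
  have "op_sum M r (bracket x y) =
      (\<Sum>w\<in>words F r. smul (M w) (unshuffle_sum (\<lambda>u v. bracket (ad_word b u x) (ad_word b v y)) w))"
    by (simp add: op_sum_def unshuffle_sum_bracket)
  then show ?thesis
    using assms by (simp add: sum_words_unshuffle symmetral_def op_sum_def
      bracket_weighted_sums)
qed

text \<open>The analogue of \<open>op_sum_bracket\<close> in which \<open>nested_sum M\<close>
  stands for the image of the formal length derivation.\<close>

lemma op_sum_length:
  assumes "symmetral M"
  shows "smul (of_nat r) (op_sum M r y) = (\<Sum>i\<le>r. bracket (nested_sum M i) (op_sum M (r - i) y))"
proof -
  have "smul (of_nat r) (op_sum M r y) = (\<Sum>w\<in>words F r. smul (M w)
      (unshuffle_sum (\<lambda>u v. bracket (nested_bracket bracket b u) (ad_word b v y)) w))"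
    by (simp add: op_sum_def unshuffle_sum_nested_bracket scale_sum_right words_def mult.commute)
  then show ?thesis
    using assms by (simp add: sum_words_unshuffle symmetral_def op_sum_def
      nested_sum_def bracket_weighted_sums)
qed

section \<open>The homogeneous components of the image of \<open>X\<^sub>0 + B\<close>\<close>

abbreviation "\<Psi> \<equiv> op_sum (S_coeff \<phi>)"
abbreviation "\<R> \<equiv> op_sum (R_coeff \<phi>)"
abbreviation "P \<equiv> nested_sum (S_coeff \<phi>)"
abbreviation "N \<equiv> nested_sum (R_coeff \<phi>)"
abbreviation "B \<equiv> \<Sum>n\<in>F. b n"

text \<open>\<open>B\<close> itself counts as one letter, hence the shift in its index.\<close>

definition image_part :: "nat \<Rightarrow> 'a" where
  "image_part r = \<Psi> r X\<^sub>0 + (case r of 0 \<Rightarrow> 0 | Suc k \<Rightarrow> \<Psi> k B)"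

lemma op_sum_S_0 [simp]: "\<Psi> 0 x = x"
  using symmetral_S_coeff[of \<phi>] by (simp add: op_sum_0 symmetral_def)

lemma op_sum_R_0 [simp]: "\<R> 0 x = 0"
  by (simp add: op_sum_0 R_coeff_def)

lemma image_part_0 [simp]: "image_part 0 = X\<^sub>0"
  by (simp add: image_part_def)

lemma op_sum_equation:
  "bracket X\<^sub>0 (\<Psi> (Suc k) x) - \<Psi> (Suc k) (bracket X\<^sub>0 x) =
     \<Psi> k (bracket B x) - (\<Sum>i\<le>Suc k. \<R> i (\<Psi> (Suc k - i) x))"
  unfolding op_sum_letter[symmetric] op_sum_mould_mult[symmetric] op_sum_weight[symmetric]
    S_coeff_equation
  by (simp add: op_sum_def scale_left_diff_distrib sum_subtractf)

lemma nested_sum_equation: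
  "bracket X\<^sub>0 (P (Suc k)) = \<Psi> k B - (\<Sum>i<Suc k. \<R> i (P (Suc k - i))) - N (Suc k)"
proof -
  have "bracket X\<^sub>0 (P (Suc k)) = \<Psi> k B - nested_sum (mould_mult (R_coeff \<phi>) (S_coeff \<phi>)) (Suc k)"
    unfolding nested_sum_letter[symmetric] nested_sum_weight[symmetric] S_coeff_equation
    by (simp add: nested_sum_def scale_left_diff_distrib sum_subtractf)
  moreover have "S_coeff \<phi> [] = 1"
    using symmetral_S_coeff[of \<phi>] by (simp add: symmetral_def)
  ultimately show ?thesis
    by (simp add: nested_sum_mould_mult del: sum.lessThan_Suc)
qed

text \<open>Expand the image of \<open>[X\<^sub>0 + B, y]\<close> in two ways, by compatibility with
  brackets and by the mould equation, and compare the components of length \<open>r\<close>.\<close>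

lemma bracket_image_part: "0 < r \<Longrightarrow> bracket (image_part r) y = \<R> r y"
proof (induction r arbitrary: y rule: less_induct)
  case (less r)
  then obtain k where k: "r = Suc k"
    using gr0_implies_Suc by blast
  let ?Q = image_part
  have "(\<Sum>i\<le>Suc k. bracket (?Q i) (\<Psi> (Suc k - i) y)) =
      (\<Sum>i\<le>Suc k. bracket (\<Psi> i X\<^sub>0) (\<Psi> (Suc k - i) y)) + (\<Sum>i\<le>k. bracket (\<Psi> i B) (\<Psi> (k - i) y))"
    by (simp add: image_part_def bracket_add_left sum.distrib sum.atMost_Suc_shift del: sum.atMost_Suc)
  also have "\<dots> = \<Psi> (Suc k) (bracket X\<^sub>0 y) + \<Psi> k (bracket B y)"
    by (simp only: op_sum_bracket[OF symmetral_S_coeff])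
  also have "\<dots> = bracket X\<^sub>0 (\<Psi> (Suc k) y) + (\<Sum>i\<le>Suc k. \<R> i (\<Psi> (Suc k - i) y))"
    using op_sum_equation[of k y] by (simp add: algebra_simps del: sum.atMost_Suc)
  finally have "bracket X\<^sub>0 (\<Psi> (Suc k) y) + (\<Sum>i\<le>k. bracket (?Q (Suc i)) (\<Psi> (k - i) y)) =
      bracket X\<^sub>0 (\<Psi> (Suc k) y) + (\<Sum>i\<le>k. \<R> (Suc i) (\<Psi> (k - i) y))"
    by (simp add: sum.atMost_Suc_shift del: sum.atMost_Suc)
  then have "(\<Sum>i<Suc k. bracket (?Q (Suc i)) (\<Psi> (k - i) y)) = (\<Sum>i<Suc k. \<R> (Suc i) (\<Psi> (k - i) y))"
    unfolding lessThan_Suc_atMost by simp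
  \<comment> \<open>The lower components agree by induction, applied to the elements
    \<open>\<Psi> (k - i) y\<close>. What remains is \<open>i = k\<close>, where
    \<open>\<Psi> 0\<close> is the identity.\<close>
  moreover have "(\<Sum>i<k. bracket (?Q (Suc i)) (\<Psi> (k - i) y)) = (\<Sum>i<k. \<R> (Suc i) (\<Psi> (k - i) y))"
    using less.IH k by (intro sum.cong) auto
  ultimately show ?case
    by (simp add: k)
qed

text \<open>\<open>\<Psi> (X\<^sub>0 + B)\<close> is identified without passing through \<open>ad\<close>, which would lose the centre.\<close>

lemma image_part_eq:
  assumes "0 < r"
  shows "smul (of_nat r) (image_part r) = N r"
proof -
  obtain k where k: "r = Suc k"
    using assms gr0_implies_Suc by blast
  let ?Q = image_part
  \<comment> \<open>In the second part of \<open>?Q r\<close> one of the \<open>r\<close> letters is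
    \<open>B\<close>, so only \<open>k\<close> belong to the operator and one copy of
    \<open>\<Psi> k B\<close> is left over.\<close>
  have "smul (of_nat r) (?Q r) =
      smul (of_nat (Suc k)) (\<Psi> (Suc k) X\<^sub>0) + smul (of_nat k) (\<Psi> k B) + \<Psi> k B"
    by (simp add: k image_part_def scale_right_distrib scale_left_distrib algebra_simps)
  also have "\<dots> = (\<Sum>i\<le>Suc k. bracket (P i) (\<Psi> (Suc k - i) X\<^sub>0))
      + (\<Sum>i\<le>k. bracket (P i) (\<Psi> (k - i) B)) + \<Psi> k B"
    by (simp only: op_sum_length[OF symmetral_S_coeff])
  also have "\<dots> = (\<Sum>i\<le>k. bracket (P i) (\<Psi> (Suc k - i) X\<^sub>0 + \<Psi> (k - i) B)) + bracket (P (Suc k)) X\<^sub>0 + \<Psi> k B"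
    by (simp add: bracket_add_right sum.distrib algebra_simps)
  also have "(\<Sum>i\<le>k. bracket (P i) (\<Psi> (Suc k - i) X\<^sub>0 + \<Psi> (k - i) B)) = (\<Sum>i\<le>k. bracket (P i) (?Q (Suc k - i)))"
    by (intro sum.cong) (auto simp: image_part_def Suc_diff_le)
  \<comment> \<open>The components \<open>?Q\<close> occur here only inside brackets and with
    positive index, so \<open>bracket_image_part\<close> applies.\<close>
  also have "\<dots> = - (\<Sum>i\<le>k. \<R> (Suc k - i) (P i))"
    unfolding sum_negf[symmetric]
    by (intro sum.cong refl) (subst bracket_anticommute, simp add: bracket_image_part)
  \<comment> \<open>Index 0 is dropped since \<open>P 0 = 0\<close>; after the reversal it can be
    added back since \<open>\<R> 0\<close> is zero.\<close>
  also have "(\<Sum>i\<le>k. \<R> (Suc k - i) (P i)) = (\<Sum>i=1..k. \<R> (Suc k - i) (P i))"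
    by (rule sum.mono_neutral_right) (auto simp: Suc_le_eq)
  also have "\<dots> = (\<Sum>i=1..k. \<R> i (P (Suc k - i)))"
    by (subst sum.atLeastAtMost_rev) (auto intro!: sum.cong)
  also have "\<dots> = (\<Sum>i<Suc k. \<R> i (P (Suc k - i)))"
    by (rule sum.mono_neutral_left) (auto simp: Suc_le_eq)
  \<comment> \<open>The leftover copy supplies the terms that cancel everything except
    \<open>N\<close>.\<close>
  also have "\<Psi> k B = bracket X\<^sub>0 (P (Suc k)) + (\<Sum>i<Suc k. \<R> i (P (Suc k - i))) + N (Suc k)"
    using nested_sum_equation[of k] by (simp add: algebra_simps del: sum.lessThan_Suc)
  also have "bracket X\<^sub>0 (P (Suc k)) = - bracket (P (Suc k)) X\<^sub>0"
    by (rule bracket_anticommute)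
  finally show ?thesis
    by (simp add: k del: sum.lessThan_Suc)
qed

lemma image_part_eq_normal_form:
  "0 < r \<Longrightarrow> image_part r = (\<Sum>w\<in>words F r. normal_form_term smul bracket \<phi> b w)"
proof -
  assume r: "0 < r"
  have "image_part r = smul (1 / of_nat r) (smul (of_nat r) (image_part r))"
    using r by simp
  then show ?thesis
    unfolding image_part_eq[OF r]
    by (simp add: nested_sum_def normal_form_term_def scale_sum_right words_def)
qed

end

subsection \<open>Formal sums in a complete filtered Lie algebra\<close>

context filtered_lie_algebra
begin

lemmas filt_zero = subspace_0[OF filt_subspace]
  and filt_add = subspace_add[OF filt_subspace]
  and filt_diff = subspace_diff[OF filt_subspace]
  and filt_scale = subspace_scale[OF filt_subspace]
  and filt_sum = subspace_sum[OF filt_subspace]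

lemma filt_mono: "x \<in> L n \<Longrightarrow> m \<le> n \<Longrightarrow> x \<in> L m"
  using filt_antimono by blast

lemma filt_bracket_right: "y \<in> L m \<Longrightarrow> bracket x y \<in> L m"
  using filt_bracket[of x 0 y m] filt_0 by simp

lemma filt_bracket_left: "x \<in> L m \<Longrightarrow> bracket x y \<in> L m"
  using filt_bracket[of x m y 0] filt_0 by simp

lemma filt_eqI:
  assumes "\<And>m. x - y \<in> L m"
  shows "x = y"
proof -
  have "x - y \<in> (\<Inter>m. L m)" using assms by blast
  then show ?thesis by (simp add: filt_separated)
qed

lemma limitin_filt:
  assumes "limitin metric.mtopology f s G"
  shows "eventually (\<lambda>x. s - f x \<in> L m) G"
proof -
  have "eventually (\<lambda>x. filt_dist L (f x) s < (1/2) ^ m) G"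
    using assms unfolding metric.limitin_metric by simp
  then show ?thesis
    by (rule eventually_mono) (simp add: filt_dist_le_iff[symmetric])
qed

lemma limitin_filtI:
  assumes "\<And>m. eventually (\<lambda>x. s - f x \<in> L m) G"
  shows "limitin metric.mtopology f s G"
  unfolding metric.limitin_metric
proof (intro conjI allI impI)
  fix e :: real
  assume "e > 0"
  then obtain m where "(1/2) ^ m < e"
    using real_arch_pow_inv[of e "1/2"] by auto
  show "eventually (\<lambda>x. f x \<in> UNIV \<and> filt_dist L (f x) s < e) G"
    using assms[of m] by (rule eventually_mono)
      (use \<open>(1/2) ^ m < e\<close> in \<open>simp add: filt_dist_le_iff[symmetric]\<close>)
qed simp

lemma sum_diff_filt:
  assumes "finite K" "J \<subseteq> K" "\<And>i. i \<in> K - J \<Longrightarrow> f i \<in> L m"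
  shows "sum f K - sum f J \<in> L m"
  using sum_diff[OF assms(1,2), of f] assms(3) filt_sum[of "K - J" f m] by simp

text \<open>Some large finite partial sum is within \<open>L m\<close> of \<open>s\<close>, and
  enlarging it by \<open>J\<close> adds only terms of \<open>L m\<close>. Identities between series
  thus reduce to finite truncations modulo every \<open>L m\<close>.\<close>

lemma has_formal_sum_approx:
  assumes "has_formal_sum L f I s" "finite J" "J \<subseteq> I" "\<And>i. i \<in> I - J \<Longrightarrow> f i \<in> L m"
  shows "s - sum f J \<in> L m"
proof -
  have "eventually (\<lambda>K. s - sum f K \<in> L m) (finite_subsets_at_top I)"
    using assms(1) unfolding has_formal_sum_def by (intro limitin_filt) simp
  then obtain K0 where "finite K0 \<and> K0 \<subseteq> I \<and>
      (\<forall>K. finite K \<and> K0 \<subseteq> K \<and> K \<subseteq> I \<longrightarrow> s - sum f K \<in> L m)"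
    unfolding eventually_finite_subsets_at_top by (rule exE)
  note K0 = this[THEN conjunct1] this[THEN conjunct2, THEN conjunct1]
    this[THEN conjunct2, THEN conjunct2, rule_format]
  have "s - sum f (K0 \<union> J) \<in> L m"
    using K0 assms by simp
  moreover have "sum f (K0 \<union> J) - sum f J \<in> L m"
    using K0 assms by (intro sum_diff_filt) auto
  ultimately show ?thesis
    using filt_add by fastforce
qed

end

section \<open>Consequences of completeness\<close>

context complete_filtered_lie_algebra
begin

lemma filt_limit:
  assumes "\<And>m n. m \<le> n \<Longrightarrow> \<sigma> n - \<sigma> m \<in> L m"
  obtains s where "\<And>m. s - \<sigma> m \<in> L m"
proof -
  have "metric.MCauchy \<sigma>"
    unfolding metric.MCauchy_def
  proof (intro conjI allI impI)
    fix e :: real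
    assume "e > 0"
    then obtain m where m: "(1/2) ^ m < e"
      using real_arch_pow_inv[of e "1/2"] by auto
    have "filt_dist L (\<sigma> n) (\<sigma> n') < e" if "m \<le> n" "m \<le> n'" for n n'
    proof -
      have "\<sigma> n' - \<sigma> m - (\<sigma> n - \<sigma> m) \<in> L m"
        by (intro filt_diff assms that)
      then have "filt_dist L (\<sigma> n) (\<sigma> n') \<le> (1/2) ^ m"
        by (simp add: filt_dist_le_iff)
      then show ?thesis using m by simp
    qed
    then show "\<exists>N. \<forall>n n'. N \<le> n \<longrightarrow> N \<le> n' \<longrightarrow> filt_dist L (\<sigma> n) (\<sigma> n') < e"
      by blast
  qed simp
  then obtain s where s: "limitin metric.mtopology \<sigma> s sequentially"
    using filt_complete unfolding metric.mcomplete_def by blast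
  have "s - \<sigma> m \<in> L m" for m
  proof -
    obtain n where "s - \<sigma> n \<in> L m" "m \<le> n"
      using limitin_filt[OF s, of m] unfolding eventually_sequentially
      by (metis max.cobounded1 max.cobounded2)
    then have "(s - \<sigma> n) + (\<sigma> n - \<sigma> m) \<in> L m"
      by (intro filt_add assms)
    then show ?thesis by simp
  qed
  then show ?thesis using that by blast
qed

text \<open>The sums over the finite exceptional sets \<open>J m\<close> form a Cauchy sequence, and
  its limit is also the limit along all finite subsets.\<close>

lemma has_formal_sum_exists:
  assumes conv: "formally_convergent L f I"
  shows "has_formal_sum L f I (formal_sum L f I)"
proof -
  define J where "J m = {i \<in> I. f i \<notin> L m}" for m
  have fin: "finite (J m)" for m
    using conv by (simp add: formally_convergent_def J_def)
  have "sum f (J n) - sum f (J m) \<in> L m" if "m \<le> n" for m n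
    using filt_mono[OF _ that] by (intro sum_diff_filt fin) (auto simp: J_def)
  then obtain s where s: "\<And>m. s - sum f (J m) \<in> L m"
    using filt_limit[of "\<lambda>m. sum f (J m)"] by blast
  have "has_formal_sum L f I s"
    unfolding has_formal_sum_def
  proof (intro conjI conv limitin_filtI)
    fix m
    have "s - sum f K \<in> L m" if "finite K" "J m \<subseteq> K" "K \<subseteq> I" for K
    proof -
      have "sum f K - sum f (J m) \<in> L m"
        using that by (intro sum_diff_filt) (auto simp: J_def)
      then have "s - sum f (J m) - (sum f K - sum f (J m)) \<in> L m"
        by (rule filt_diff[OF s])
      then show ?thesis by simp
    qed
    then show "eventually (\<lambda>K. s - sum f K \<in> L m) (finite_subsets_at_top I)"
      unfolding eventually_finite_subsets_at_top using fin[of m]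
      by (intro exI[of _ "J m"]) (auto simp: J_def)
  qed
  then show ?thesis by (simp add: formal_sum_eq)
qed

text \<open>An element of the kernel climbs through the whole filtration and is zero by
  separatedness. Preimages come from successive correction, each step gaining one degree.\<close>

lemma bij_unipotent:
  assumes add: "\<And>x y. f (x + y) = f x + f y"
    and unip: "\<And>k x. x \<in> L k \<Longrightarrow> f x - x \<in> L (Suc k)"
  shows "bij f"
proof -
  have diff: "f (x - y) = f x - f y" for x y
    using add[of "x - y" y] by (simp add: algebra_simps)
  have pres: "f x \<in> L k" if "x \<in> L k" for x k
    using filt_add[OF filt_mono[OF unip[OF that], of k] that] by simp
  have "x = y" if "f x = f y" for x y
  proof (rule filt_eqI)
    fix m
    show "x - y \<in> L m"
    proof (induction m)
      case (Suc m)
      from filt_diff[OF filt_zero unip[OF this]] show ?case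
        by (simp add: diff that)
    qed (simp add: filt_0)
  qed
  moreover have "\<exists>x. f x = y" for y
  proof -
    \<comment> \<open>The current error \<open>y - f x\<close> is added to \<open>x\<close>; since
      \<open>f\<close> is the identity up to higher order, the next error lies one level
      deeper.\<close>
    define \<sigma> where "\<sigma> k = ((\<lambda>x. x + (y - f x)) ^^ k) 0" for k
    have \<sigma>_Suc: "\<sigma> (Suc k) = \<sigma> k + (y - f (\<sigma> k))" for k
      by (simp add: \<sigma>_def)
    have err: "y - f (\<sigma> k) \<in> L k" for k
    proof (induction k)
      case (Suc k)
      from filt_diff[OF filt_zero unip[OF this]] show ?case
        by (simp add: \<sigma>_Suc add diff_diff_eq)
    qed (simp add: filt_0)
    have "\<sigma> n - \<sigma> m \<in> L m" if "m \<le> n" for m n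
      using that
    proof (induction n rule: dec_induct)
      case (step n)
      have "(\<sigma> n - \<sigma> m) + (y - f (\<sigma> n)) \<in> L m"
        using step filt_mono[OF err] by (intro filt_add) auto
      then show ?case by (simp add: \<sigma>_Suc algebra_simps)
    qed (simp add: filt_zero)
    then obtain s where s: "\<And>m. s - \<sigma> m \<in> L m"
      using filt_limit by blast
    have "y - f s \<in> L m" for m
      using filt_diff[OF err[of m] pres[OF s[of m]]] by (simp add: diff)
    then show ?thesis
      using filt_eqI by metis
  qed
  ultimately show ?thesis
    by (metis injI surj_def bijI)
qed

end

subsection \<open>The normalization problem\<close>

locale normalization_problem = complete_filtered_lie_algebra smul bracket L
  for smul :: "'k::field_char_0 \<Rightarrow> 'a::ab_group_add \<Rightarrow> 'a" and bracket :: "'a \<Rightarrow> 'a \<Rightarrow> 'a"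
    and L :: "nat \<Rightarrow> 'a set" +
  fixes X\<^sub>0 B :: 'a and Idx :: "'n set" and b :: "'n \<Rightarrow> 'a" and \<phi> :: "'n \<Rightarrow> 'k"
  assumes B_sum: "has_formal_sum L b Idx B"
    and b_filt: "n \<in> Idx \<Longrightarrow> b n \<in> L 1"
    and b_eigen: "n \<in> Idx \<Longrightarrow> bracket X\<^sub>0 (b n) = smul (\<phi> n) (b n)"
begin

text \<open>The alphabet modulo \<open>L m\<close>: finite by formal convergence, while a word using
  any other letter of \<open>Idx\<close> has all its brackets in \<open>L m\<close>.\<close>

definition letters :: "nat \<Rightarrow> 'n set" where
  "letters m = {n \<in> Idx. b n \<notin> L m}"

lemma finite_letters: "finite (letters m)"
  using B_sum by (simp add: letters_def has_formal_sum_def formally_convergent_def)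

lemma letters_subset: "letters m \<subseteq> Idx"
  by (auto simp: letters_def)

lemma eigenletters: "eigenletters smul bracket b \<phi> X\<^sub>0 (letters m)"
  by unfold_locales (simp add: b_eigen letters_def)

lemma B_approx: "B - (\<Sum>n\<in>letters m. b n) \<in> L m"
  by (rule has_formal_sum_approx[OF B_sum finite_letters letters_subset]) (simp add: letters_def)

lemma ad_word_filt: "set w \<subseteq> Idx \<Longrightarrow> x \<in> L k \<Longrightarrow> ad_word b w x \<in> L (length w + k)"
proof (induction w)
  case (Cons n w)
  then have "bracket (b n) (ad_word b w x) \<in> L (1 + (length w + k))"
    by (intro filt_bracket b_filt) simp_all
  then show ?case by simp
qed simp

lemma ad_word_filt_same: "x \<in> L m \<Longrightarrow> ad_word b w x \<in> L m"
  by (induction w) (simp_all add: filt_bracket_right)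

lemma ad_word_filt_letter: "n \<in> set w \<Longrightarrow> b n \<in> L m \<Longrightarrow> ad_word b w x \<in> L m"
proof (induction w)
  case (Cons n' w)
  then show ?case
    by (cases "n = n'") (simp_all add: filt_bracket_left filt_bracket_right)
qed simp

text \<open>The two causes of negligibility: each letter gains one degree, and a letter in the ideal
  \<open>L m\<close> keeps the whole bracket there.\<close>

lemma long_or_small:
  assumes "w \<in> lists Idx" "\<not> (w \<in> words (letters m) (length w) \<and> length w \<le> m)"
  shows "m \<le> length w \<or> (\<exists>n\<in>set w. b n \<in> L m)"
  using assms by (auto simp: words_def letters_def)

lemma ad_word_negligible:
  assumes "w \<in> lists Idx" "\<not> (w \<in> words (letters m) (length w) \<and> length w \<le> m)"
  shows "ad_word b w x \<in> L m"
  using long_or_small[OF assms]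
proof
  assume "m \<le> length w"
  moreover have "ad_word b w x \<in> L (length w + 0)"
    using assms(1) by (intro ad_word_filt) (auto simp: filt_0)
  ultimately show ?thesis using filt_mono by simp
qed (use ad_word_filt_letter in blast)

lemma nested_bracket_negligible:
  assumes "w \<in> lists Idx" "\<not> (w \<in> words (letters m) (length w) \<and> length w \<le> m)"
  shows "nested_bracket bracket b w \<in> L m"
proof (cases w rule: rev_cases)
  case (snoc v n)
  then have eq: "nested_bracket bracket b w = ad_word b v (b n)"
    by (simp add: nested_bracket_append)
  show ?thesis
    using long_or_small[OF assms]
  proof
    assume "m \<le> length w"
    moreover have "ad_word b v (b n) \<in> L (length v + 1)"
      using assms(1) snoc by (intro ad_word_filt b_filt) auto
    ultimately show ?thesis using filt_mono snoc eq by simp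
  next
    assume "\<exists>n\<in>set w. b n \<in> L m"
    then show ?thesis
      unfolding eq using snoc ad_word_filt_letter ad_word_filt_same by auto
  qed
qed (simp add: filt_zero)

lemma finite_truncation: "finite (\<Union>r\<in>{k..m}. words (letters m) r)"
  by (simp add: finite_words finite_letters)

lemma truncation_subset: "(\<Union>r\<in>{k..m}. words (letters m) r) \<subseteq> lists Idx"
  using letters_subset by (auto simp: words_def)

lemma sum_truncation:
  "(\<Sum>w\<in>(\<Union>r\<in>{k..m}. words (letters m) r). f w) = (\<Sum>r=k..m. \<Sum>w\<in>words (letters m) r. f w)"
  by (rule sum.UNION_disjoint) (auto simp: finite_words finite_letters, auto simp: words_def)

lemma normalizer_term_negligible:
  assumes "w \<in> lists Idx" "w \<notin> (\<Union>r\<in>{0..m}. words (letters m) r)"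
  shows "normalizer_term smul bracket \<phi> b x w \<in> L m"
  unfolding normalizer_term_def using assms by (intro filt_scale ad_word_negligible) auto

lemma normal_form_term_negligible:
  assumes "w \<in> lists Idx - {[]}" "w \<notin> (\<Union>r\<in>{1..m}. words (letters m) r)"
  shows "normal_form_term smul bracket \<phi> b w \<in> L m"
proof -
  have "length w \<noteq> 0" using assms(1) by simp
  then show ?thesis
    unfolding normal_form_term_def using assms
    by (intro filt_scale nested_bracket_negligible) (auto simp: Suc_le_eq)
qed

abbreviation "\<Psi> \<equiv> normalizer smul bracket L \<phi> b Idx"
abbreviation "N \<equiv> normal_form smul bracket L \<phi> b Idx"
abbreviation "\<Psi>\<^sub>m m \<equiv> eigenletters.op_sum smul bracket b (letters m) (S_coeff \<phi>)"

section \<open>Convergence and truncation of the two series\<close>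

lemma normalizer_has_formal_sum:
  "has_formal_sum L (normalizer_term smul bracket \<phi> b x) (lists Idx) (\<Psi> x)"
  unfolding normalizer_def
proof (rule has_formal_sum_exists, unfold formally_convergent_def, intro allI)
  fix m
  show "finite {w \<in> lists Idx. normalizer_term smul bracket \<phi> b x w \<notin> L m}"
    using normalizer_term_negligible[of _ m x]
    by (intro finite_subset[OF _ finite_truncation[where k = 0 and m = m]]) blast
qed

lemma normal_form_has_formal_sum:
  "has_formal_sum L (normal_form_term smul bracket \<phi> b) (lists Idx - {[]}) N"
  unfolding normal_form_def
proof (rule has_formal_sum_exists, unfold formally_convergent_def, intro allI)
  fix m
  show "finite {w \<in> lists Idx - {[]}. normal_form_term smul bracket \<phi> b w \<notin> L m}"
    using normal_form_term_negligible[of _ m]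
    by (intro finite_subset[OF _ finite_truncation[where k = 1 and m = m]]) blast
qed

lemma normalizer_approx: "\<Psi> x - (\<Sum>r\<le>m. \<Psi>\<^sub>m m r x) \<in> L m"
proof -
  interpret E: eigenletters smul bracket b \<phi> X\<^sub>0 "letters m"
    by (rule eigenletters)
  have "\<Psi> x - sum (normalizer_term smul bracket \<phi> b x) (\<Union>r\<in>{0..m}. words (letters m) r) \<in> L m"
    by (rule has_formal_sum_approx[OF normalizer_has_formal_sum finite_truncation truncation_subset])
      (blast intro: normalizer_term_negligible)
  then show ?thesis
    unfolding sum_truncation by (simp add: E.op_sum_def normalizer_term_def atLeast0AtMost)
qed

lemma normal_form_approx:
  "N - (\<Sum>r=1..m. \<Sum>w\<in>words (letters m) r. normal_form_term smul bracket \<phi> b w) \<in> L m"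
proof -
  have "(\<Union>r\<in>{1..m}. words (letters m) r) \<subseteq> lists Idx - {[]}"
    using truncation_subset[where k = 1 and m = m] by (auto simp: words_def)
  then have "N - sum (normal_form_term smul bracket \<phi> b) (\<Union>r\<in>{1..m}. words (letters m) r) \<in> L m"
    by (rule has_formal_sum_approx[OF normal_form_has_formal_sum finite_truncation])
      (blast intro: normal_form_term_negligible)
  then show ?thesis
    by (simp only: sum_truncation)
qed

section \<open>Verification of the normalization properties\<close>

lemma op_sum_filt: "x \<in> L k \<Longrightarrow> \<Psi>\<^sub>m m r x \<in> L (r + k)"
proof -
  interpret E: eigenletters smul bracket b \<phi> X\<^sub>0 "letters m"
    by (rule eigenletters)
  assume "x \<in> L k"
  then have "ad_word b w x \<in> L (r + k)" if "w \<in> words (letters m) r" for w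
    using that ad_word_filt[of w x k] letters_subset[of m] by (auto simp: words_def)
  then show ?thesis
    unfolding E.op_sum_def by (intro filt_sum filt_scale)
qed

text \<open>The empty word contributes the identity, and every nonempty word raises the
  degree.\<close>

lemma normalizer_unipotent:
  assumes "x \<in> L k"
  shows "\<Psi> x - x \<in> L (Suc k)"
proof -
  interpret E: eigenletters smul bracket b \<phi> X\<^sub>0 "letters (Suc k)"
    by (rule eigenletters)
  have "(\<Sum>r\<le>Suc k. \<Psi>\<^sub>m (Suc k) r x) - x = (\<Sum>r\<le>k. \<Psi>\<^sub>m (Suc k) (Suc r) x)"
    by (simp add: sum.atMost_Suc_shift del: sum.atMost_Suc)
  also have "\<dots> \<in> L (Suc k)"
    by (intro filt_sum filt_mono[OF op_sum_filt[OF assms]]) simp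
  finally have "(\<Psi> x - (\<Sum>r\<le>Suc k. \<Psi>\<^sub>m (Suc k) r x)) + ((\<Sum>r\<le>Suc k. \<Psi>\<^sub>m (Suc k) r x) - x) \<in> L (Suc k)"
    by (intro filt_add normalizer_approx)
  then show ?thesis by simp
qed

lemma normalizer_filt: "x \<in> L m \<Longrightarrow> \<Psi> x \<in> L m"
  using filt_add[OF filt_mono[OF normalizer_unipotent], of x m m x] by simp

lemma normalizer_add: "\<Psi> (x + y) = \<Psi> x + \<Psi> y"
proof (rule filt_eqI)
  fix m
  interpret E: eigenletters smul bracket b \<phi> X\<^sub>0 "letters m"
    by (rule eigenletters)
  let ?\<Phi> = "\<lambda>x. \<Sum>r\<le>m. \<Psi>\<^sub>m m r x"
  have "(\<Psi> (x + y) - ?\<Phi> (x + y)) - (\<Psi> x - ?\<Phi> x) - (\<Psi> y - ?\<Phi> y) \<in> L m"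
    by (intro filt_diff normalizer_approx)
  then show "\<Psi> (x + y) - (\<Psi> x + \<Psi> y) \<in> L m"
    by (simp add: E.op_sum_add_right sum.distrib algebra_simps)
qed

lemma normalizer_scale: "\<Psi> (smul c x) = smul c (\<Psi> x)"
proof (rule filt_eqI)
  fix m
  interpret E: eigenletters smul bracket b \<phi> X\<^sub>0 "letters m"
    by (rule eigenletters)
  let ?\<Phi> = "\<lambda>x. \<Sum>r\<le>m. \<Psi>\<^sub>m m r x"
  have "(\<Psi> (smul c x) - ?\<Phi> (smul c x)) - smul c (\<Psi> x - ?\<Phi> x) \<in> L m"
    by (intro filt_diff filt_scale normalizer_approx)
  moreover have "?\<Phi> (smul c x) = smul c (?\<Phi> x)"
    by (simp add: E.op_sum_def ad_word_scale scale_sum_right mult.commute)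
  ultimately show "\<Psi> (smul c x) - smul c (\<Psi> x) \<in> L m"
    by (simp add: scale_right_diff_distrib)
qed

lemma normalizer_bracket: "\<Psi> (bracket x y) = bracket (\<Psi> x) (\<Psi> y)"
proof (rule filt_eqI)
  fix m
  interpret E: eigenletters smul bracket b \<phi> X\<^sub>0 "letters m"
    by (rule eigenletters)
  let ?\<Phi> = "\<lambda>x. \<Sum>r\<le>m. \<Psi>\<^sub>m m r x"
  let ?g = "\<lambda>i j. bracket (\<Psi>\<^sub>m m i x) (\<Psi>\<^sub>m m j y)"
  have 1: "?\<Phi> (bracket x y) = (\<Sum>(i, j)\<in>{(i, j). i + j \<le> m}. ?g i j)"
    unfolding sum.triangle_reindex_eq by (simp add: E.op_sum_bracket symmetral_S_coeff)
  have 2: "bracket (?\<Phi> x) (?\<Phi> y) = (\<Sum>(i, j)\<in>{..m} \<times> {..m}. ?g i j)"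
    unfolding bracket_sum_left unfolding bracket_sum_right by (simp add: sum.cartesian_product)
  \<comment> \<open>Truncation does not commute with the bracket: the square of pairs exceeds the
    triangle, but the excess pairs have total length above \<open>m\<close>.\<close>
  have 3: "bracket (?\<Phi> x) (?\<Phi> y) - ?\<Phi> (bracket x y) \<in> L m"
    unfolding 1 2
  proof (rule sum_diff_filt)
    fix p
    assume "p \<in> {..m} \<times> {..m} - {(i, j). i + j \<le> m}"
    then obtain i j where p: "p = (i, j)" "m \<le> i + j" by auto
    have "?g i j \<in> L ((i + 0) + (j + 0))"
      by (intro filt_bracket op_sum_filt) (simp_all add: filt_0)
    then show "(case p of (i, j) \<Rightarrow> ?g i j) \<in> L m"
      using p filt_mono by simp
  qed auto
  have 4: "bracket (\<Psi> x) (\<Psi> y - ?\<Phi> y) \<in> L m" "bracket (\<Psi> x - ?\<Phi> x) (?\<Phi> y) \<in> L m"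
    by (intro filt_bracket_right filt_bracket_left normalizer_approx)+
  have "(\<Psi> (bracket x y) - ?\<Phi> (bracket x y)) - (bracket (?\<Phi> x) (?\<Phi> y) - ?\<Phi> (bracket x y))
      - bracket (\<Psi> x) (\<Psi> y - ?\<Phi> y) - bracket (\<Psi> x - ?\<Phi> x) (?\<Phi> y) \<in> L m"
    by (intro filt_diff normalizer_approx 3 4)
  then show "\<Psi> (bracket x y) - bracket (\<Psi> x) (\<Psi> y) \<in> L m"
    by (simp add: bracket_diff_left bracket_diff_right algebra_simps)
qed

lemma lie_automorphism_normalizer: "lie_automorphism smul bracket \<Psi>"
  unfolding lie_automorphism_def Vector_Spaces.linear_iff
  using bij_unipotent[OF normalizer_add normalizer_unipotent] vector_space_axioms
  by (simp add: normalizer_add normalizer_scale normalizer_bracket)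

lemma normalizer_image: "\<Psi> (X\<^sub>0 + B) = X\<^sub>0 + N"
proof (rule filt_eqI)
  fix m
  interpret E: eigenletters smul bracket b \<phi> X\<^sub>0 "letters m"
    by (rule eigenletters)
  let ?\<Phi> = "\<lambda>x. \<Sum>r\<le>m. \<Psi>\<^sub>m m r x"
  let ?B = "\<Sum>n\<in>letters m. b n"
  let ?N = "\<Sum>r=1..m. \<Sum>w\<in>words (letters m) r. normal_form_term smul bracket \<phi> b w"
  have "?N = (\<Sum>r=1..m. E.image_part r)"
    by (intro sum.cong) (simp_all add: E.image_part_eq_normal_form)
  also have "\<dots> = (\<Sum>k<m. \<Psi>\<^sub>m m (Suc k) X\<^sub>0) + (\<Sum>k<m. \<Psi>\<^sub>m m k ?B)"
    unfolding One_nat_def sum.atLeast1_atMost_eq by (simp add: E.image_part_def sum.distrib)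
  finally have N: "?N = (\<Sum>k<m. \<Psi>\<^sub>m m (Suc k) X\<^sub>0) + (\<Sum>k<m. \<Psi>\<^sub>m m k ?B)" .
  have "?\<Phi> X\<^sub>0 = X\<^sub>0 + (\<Sum>k<m. \<Psi>\<^sub>m m (Suc k) X\<^sub>0)"
    by (simp add: sum.atMost_shift)
  \<comment> \<open>The components of length at most \<open>m\<close> involve
    \<open>\<Psi>\<^sub>m m k ?B\<close> only for \<open>k < m\<close>. The extra top term has
    \<open>m\<close> letters and lies in \<open>L m\<close>.\<close>
  moreover have "?\<Phi> ?B = (\<Sum>k<m. \<Psi>\<^sub>m m k ?B) + \<Psi>\<^sub>m m m ?B"
    unfolding lessThan_Suc_atMost[symmetric] by (rule sum.lessThan_Suc)
  ultimately have eq: "?\<Phi> (X\<^sub>0 + ?B) = X\<^sub>0 + ?N + \<Psi>\<^sub>m m m ?B"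
    unfolding N E.op_sum_add_right sum.distrib by (simp only: add.assoc)
  have "(\<Psi> (X\<^sub>0 + ?B) - ?\<Phi> (X\<^sub>0 + ?B)) + \<Psi>\<^sub>m m m ?B + \<Psi> (B - ?B) - (N - ?N) \<in> L m"
    using op_sum_filt[of ?B 0 m m]
    by (intro filt_diff[OF filt_add[OF filt_add[OF normalizer_approx] normalizer_filt[OF B_approx]]]
        normal_form_approx) (simp add: filt_0)
  moreover have "\<Psi> (X\<^sub>0 + ?B) + \<Psi> (B - ?B) = \<Psi> (X\<^sub>0 + B)"
    by (simp add: normalizer_add[symmetric])
  ultimately show "\<Psi> (X\<^sub>0 + B) - (X\<^sub>0 + N) \<in> L m"
    unfolding eq by (simp add: algebra_simps)
qed

text \<open>Each word contributes its eigenvalue times its coefficient \<open>R\<close>, which is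
  zero by \<open>R_coeff_resonant\<close>; only the negligible tail remains.\<close>

lemma bracket_normal_form: "bracket X\<^sub>0 N = 0"
proof (rule filt_eqI)
  fix m
  interpret E: eigenletters smul bracket b \<phi> X\<^sub>0 "letters m"
    by (rule eigenletters)
  let ?N = "\<Sum>r=1..m. \<Sum>w\<in>words (letters m) r. normal_form_term smul bracket \<phi> b w"
  have "bracket X\<^sub>0 (normal_form_term smul bracket \<phi> b w) = 0" if "w \<in> words (letters m) r" for w r
    using that R_coeff_resonant[of \<phi> w] E.bracket_nested_bracket[of w]
    by (auto simp: normal_form_term_def words_def bracket_scale_right)
  then have "bracket X\<^sub>0 ?N = 0"
    by (simp add: bracket_sum_right)
  moreover have "bracket X\<^sub>0 (N - ?N) \<in> L m"
    by (intro filt_bracket_right normal_form_approx)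
  ultimately show "bracket X\<^sub>0 N - 0 \<in> L m"
    by (simp add: bracket_diff_right)
qed

end

theorem theorem3:
  fixes smul :: "'k::field_char_0 \<Rightarrow> 'a::ab_group_add \<Rightarrow> 'a"
    and bracket :: "'a \<Rightarrow> 'a \<Rightarrow> 'a"
    and L :: "nat \<Rightarrow> 'a set"
    and X\<^sub>0 B :: 'a
    and Idx :: "'n set"
    and b :: "'n \<Rightarrow> 'a"
    and \<phi> :: "'n \<Rightarrow> 'k"
  assumes "complete_filtered_lie_algebra smul bracket L"
    and "B \<in> L 1"
    and "Idx \<noteq> {}"
    and "has_formal_sum L b Idx B"
    and "\<And>n. n \<in> Idx \<Longrightarrow> b n \<in> L 1"
    and "\<And>n. n \<in> Idx \<Longrightarrow> bracket X\<^sub>0 (b n) = smul (\<phi> n) (b n)"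
  shows "has_formal_sum L (normal_form_term smul bracket \<phi> b) (lists Idx - {[]})
           (normal_form smul bracket L \<phi> b Idx) \<and>
         (\<forall>x. has_formal_sum L (normalizer_term smul bracket \<phi> b x) (lists Idx)
           (normalizer smul bracket L \<phi> b Idx x)) \<and>
         lie_automorphism smul bracket (normalizer smul bracket L \<phi> b Idx) \<and>
         normalizer smul bracket L \<phi> b Idx (X\<^sub>0 + B) = X\<^sub>0 + normal_form smul bracket L \<phi> b Idx \<and>
         bracket X\<^sub>0 (normal_form smul bracket L \<phi> b Idx) = 0"
proof -
  interpret complete_filtered_lie_algebra smul bracket L
    by (rule assms(1))
  interpret normalization_problem smul bracket L X\<^sub>0 B Idx b \<phi>
    by unfold_locales (use assms in auto)
  show ?thesis
    using normal_form_has_formal_sum normalizer_has_formal_sum lie_automorphism_normalizer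
      normalizer_image bracket_normal_form by blast
qed

end
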